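(* Let $C$ be a convex body of constant width in $\mathbb{R}^2$, and let $k$ be a positive integer. If $C$ is a Reuleaux polygon with $2s+1$ sides, then $a_k(C)=2k+\left\lceil \frac{k}{s}\right\rceil$; otherwise (that is, if $C$ is not a Reuleaux polygon) $a_k(C)=2k+1$.
   Context: For a set $S\subset\mathbb{R}^n$ of diameter $d>0$ (finite) and a positive integer $k$, the $k$-fold Borsuk number $a_k(S)$ is the smallest positive integer $m$ such that there is a $k$-fold cover of $S$ with $m$ sets of diameters strictly less than $d$. A $k$-fold cover of $S$ is a family of sets such that any point of $S$ belongs to at least $k$ members of the family; some members of the family are permitted to coincide (they are counted with multiplicity). A convex body is a compact convex set with nonempty interior; a plane convex body has constant width $w$ if the distance between any two of its parallel supporting lines is $w$. A Reuleaux polygon is a plane convex body of constant width bounded by finitely many circle arcs of radius equal to the width of the body; these (maximal) arcs are called the sides of the polygon. It is well known that a Reuleaux polygon has an odd number $2s+1$ of sides ($s\ge 1$). *)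

theory Defs
  imports "HOL-Analysis.Analysis"
begin

text \<open>A family of \<open>m\<close> sets is an indexed family \<open>F 0, \<dots>, F (m - 1)\<close>, so coinciding members are
  counted with multiplicity.\<close>

definition kfold_cover :: "nat \<Rightarrow> 'a set \<Rightarrow> nat \<Rightarrow> (nat \<Rightarrow> 'a set) \<Rightarrow> bool" where
  "kfold_cover k S m F \<longleftrightarrow> (\<forall>x\<in>S. k \<le> card {i. i < m \<and> x \<in> F i})"

text \<open>The library's \<^const>\<open>diameter\<close> is a real supremum and carries no information for unbounded sets;
  hence the explicit boundedness of the members. The number is meaningful for bounded sets of
  positive diameter.\<close>

definition kfold_borsuk_number :: "nat \<Rightarrow> 'a::metric_space set \<Rightarrow> nat" where
  "kfold_borsuk_number k S =
     (LEAST m. 0 < m \<and>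
        (\<exists>F. kfold_cover k S m F \<and> (\<forall>i<m. bounded (F i) \<and> diameter (F i) < diameter S)))"

definition convex_body :: "'a::euclidean_space set \<Rightarrow> bool" where
  "convex_body C \<longleftrightarrow> compact C \<and> convex C \<and> interior C \<noteq> {}"

definition supporting_line :: "(real^2) set \<Rightarrow> (real^2) set \<Rightarrow> bool" where
  "supporting_line C L \<longleftrightarrow>
     (\<exists>u b. u \<noteq> 0 \<and> L = {x. u \<bullet> x = b} \<and> C \<subseteq> {x. u \<bullet> x \<le> b} \<and> L \<inter> C \<noteq> {})"

definition constant_width :: "real \<Rightarrow> (real^2) set \<Rightarrow> bool" where
  "constant_width w C \<longleftrightarrow>
     (\<forall>L L'. supporting_line C L \<and> supporting_line C L' \<and> L \<noteq> L' \<and> affine_parallel L L'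
        \<longrightarrow> setdist L L' = w)"

definition circle_arc :: "real \<Rightarrow> (real^2) set \<Rightarrow> bool" where
  "circle_arc r A \<longleftrightarrow> (\<exists>c g. arc g \<and> path_image g = A \<and> A \<subseteq> sphere c r)"

definition reuleaux_polygon_of_width :: "real \<Rightarrow> (real^2) set \<Rightarrow> bool" where
  "reuleaux_polygon_of_width w C \<longleftrightarrow>
     convex_body C \<and> constant_width w C \<and>
     (\<exists>\<A>. finite \<A> \<and> (\<forall>A\<in>\<A>. circle_arc w A) \<and> frontier C = \<Union>\<A>)"

text \<open>The arcs in the finite family above may overlap or be subdivided; the sides are the
  inclusion-maximal arcs.\<close>

definition reuleaux_sides :: "real \<Rightarrow> (real^2) set \<Rightarrow> (real^2) set set" where
  "reuleaux_sides w C =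
     {A. circle_arc w A \<and> A \<subseteq> frontier C \<and>
         (\<forall>B. circle_arc w B \<and> A \<subseteq> B \<and> B \<subseteq> frontier C \<longrightarrow> B = A)}"

definition reuleaux_polygon :: "(real^2) set \<Rightarrow> bool" where
  "reuleaux_polygon C \<longleftrightarrow> (\<exists>w. reuleaux_polygon_of_width w C)"

definition reuleaux_polygon_with_sides :: "nat \<Rightarrow> (real^2) set \<Rightarrow> bool" where
  "reuleaux_polygon_with_sides n C \<longleftrightarrow>
     (\<exists>w. reuleaux_polygon_of_width w C \<and> card (reuleaux_sides w C) = n)"

end

theory Submission
  imports Defs
begin

text \<open>
  Let \<open>w\<close> be the width of \<open>C\<close> and \<open>x(t)\<close> the point at which \<open>C\<close> touches its supporting line with
  outer normal \<open>(cos t, sin t)\<close>. Constant width means \<open>x(t) - x(t + pi) = w (cos t, sin t)\<close>; hence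
  \<open>x\<close> is a continuous closed curve running around the boundary, the diameter is \<open>w\<close>, and the
  pairs of points at distance \<open>w\<close> are exactly the pairs \<open>x(t), x(t + pi)\<close>. The problem is therefore
  one about the circle of directions, in which the normal cone of a vertex, an interval on
  which \<open>x\<close> is constant, has to be regarded as a single point. The points in the interior of \<open>C\<close>
  are covered by coning the pieces of the boundary to an interior point (\<open>cone_extension\<close>).

  At least \<open>2 k + 1\<close> sets are needed for every \<open>C\<close>: opposite points lie in different sets, so
  \<open>2 k\<close> sets would split into complementary groups at each pair of opposite points, and the
  boundary, being connected, cannot pass from one of the groups to the other
  (\<open>borsuk_lower_bound\<close>).

  Conversely, \<open>2 k + 1\<close> boundary arcs suffice if there are \<open>2 k + 1\<close> boundary points such that, going
  around the circle of directions, their normal cones alternate with the opposites of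
  their normal cones and no two of all these intervals meet (\<open>cover_of_interleaved_arcs\<close>). A
  direction is called switching if neither \<open>x\<close> near it nor \<open>x\<close> near the opposite direction is
  constant on an interval around it. Normal cones do not extend beyond a switching direction. So if
  there are infinitely many of these, the required points are obtained by choosing every fourth
  member of a long finite sequence of switching directions (\<open>cover_if_infinitely_many_switches\<close>).

  If there are only finitely many switching directions, then between neighbouring ones either \<open>x\<close> is
  constant, or its opposite is constant and \<open>x\<close> runs through a circle arc of radius \<open>w\<close>; these two
  cases alternate (\<open>reuleaux_angles_if_finite\<close>). So \<open>C\<close> is a Reuleaux polygon, and the number
  \<open>2 s + 1\<close> of its sides is the number of switching directions in a half turn (\<open>card_sides\<close>).
  The vertices form an odd cycle of points at distance \<open>w\<close>, so each set contains at most \<open>s\<close> of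
  them, and counting incidences gives \<open>m s \<ge> k (2 s + 1)\<close> for \<open>m\<close> sets (\<open>polygon_lower_bound\<close>). On the
  other hand, the interior points of the sides alternate strictly with the opposite vertices, which
  yields covers with \<open>2 k + 1\<close> sets for \<open>k \<le> s\<close> (\<open>short_cover\<close>); joining \<open>s\<close>-fold covers
  and at most one shorter cover attains the bound for all \<open>k\<close> (\<open>polygon_cover\<close>). Conversely, every
  Reuleaux polygon has only finitely many switching directions, because one of \<open>x(t)\<close> and
  \<open>x(t + pi)\<close> is always the centre of one of its finitely many arcs
  (\<open>finitely_many_switches\<close>).
\<close>

section \<open>Directions in the plane\<close>

definition dir :: "real \<Rightarrow> real^2" where
  "dir \<theta> = cos \<theta> *\<^sub>R axis 1 1 + sin \<theta> *\<^sub>R axis 2 1"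

lemma inner_dir: "dir a \<bullet> dir b = cos (a - b)"
  by (simp add: dir_def inner_add_left inner_add_right inner_axis_axis cos_diff)

lemma norm_dir [simp]: "norm (dir \<theta>) = 1"
  by (simp add: norm_eq_sqrt_inner inner_dir)

lemma dir_nonzero [simp]: "dir \<theta> \<noteq> 0"
  using norm_dir[of \<theta>] by (metis norm_zero zero_neq_one)

lemma dir_add_pi: "dir (\<theta> + pi) = - dir \<theta>"
  by (simp add: dir_def)

lemma continuous_on_dir: "continuous_on S dir"
  unfolding dir_def by (intro continuous_intros)

lemma dir_plus_turns: "dir (\<theta> + 2 * pi * of_int q) = dir \<theta>"
  using sin_int_2pin[of q] cos_int_2pin[of q] by (simp add: dir_def sin_add cos_add)

lemma dir_eqD:
  assumes "dir a = dir b"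
  obtains q :: int where "a = b + 2 * pi * of_int q"
proof -
  have "cos (a - b) = 1"
    using assms inner_dir[of a b] inner_dir[of b b] by simp
  then obtain q :: int where "a - b = of_int q * 2 * pi"
    using cos_one_2pi_int by blast
  then show thesis
    by (intro that[of q]) (simp add: algebra_simps)
qed

lemma dir_neq:
  assumes "a < b" "b < a + 2 * pi"
  shows "dir a \<noteq> dir b"
proof
  assume "dir a = dir b"
  then obtain q :: int where q: "b = a + 2 * pi * of_int q"
    using dir_eqD[of b a] by metis
  with assms have "0 < 2 * pi * real_of_int q" "2 * pi * real_of_int q < 2 * pi * 1"
    by auto
  then have "0 < real_of_int q" "real_of_int q < 1"
    by (auto simp: zero_less_mult_iff)
  then have "0 < q" "q < 1" by (simp_all only: of_int_0_less_iff of_int_less_1_iff)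
  then show False by simp
qed

lemma unit_vector_dir:
  fixes v :: "real^2"
  assumes "norm v = 1"
  obtains \<theta> where "v = dir \<theta>"
proof -
  have "(v $ 1)\<^sup>2 + (v $ 2)\<^sup>2 = 1"
    using assms by (simp add: norm_vec_def L2_set_def sum_2)
  then obtain t where "v $ 1 = cos t" "v $ 2 = sin t"
    using sincos_total_2pi by metis
  then have "v = dir t"
    by (simp add: dir_def vec_eq_iff forall_2 axis_def)
  then show thesis by (rule that)
qed

text \<open>For \<open>a \<le> c \<le> b < a + pi\<close> all three sines are nonnegative, so this exhibits \<open>dir c\<close> in the cone
  spanned by \<open>dir a\<close> and \<open>dir b\<close>.\<close>

lemma dir_between:
  "sin (b - a) *\<^sub>R dir c = sin (b - c) *\<^sub>R dir a + sin (c - a) *\<^sub>R dir b"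
proof -
  have ca: "sin (b - a) * cos c = sin (b - c) * cos a + sin (c - a) * cos b"
    and sa: "sin (b - a) * sin c = sin (b - c) * sin a + sin (c - a) * sin b"
    unfolding sin_diff using sin_cos_squared_add[of c] by algebra+
  show ?thesis
    by (simp add: vec_eq_iff forall_2 dir_def axis_def ca sa)
qed

text \<open>The case of equality in the Cauchy-Schwarz inequality.\<close>

lemma unit_vector_from_inner:
  fixes u d :: "'a::real_inner"
  assumes "norm u = 1" "u \<bullet> d = w" "norm d \<le> w"
  shows "d = w *\<^sub>R u"
proof -
  have "w \<ge> 0" using assms(3) norm_ge_zero order_trans by blast
  have "(norm d)\<^sup>2 \<le> w\<^sup>2" using assms(3) by (intro power_mono) auto
  then have "d \<bullet> d \<le> w\<^sup>2" by (simp add: power2_norm_eq_inner)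
  moreover have "u \<bullet> u = 1" using assms(1) by (simp add: norm_eq_1)
  moreover have "(d - w *\<^sub>R u) \<bullet> (d - w *\<^sub>R u) = d \<bullet> d - 2 * w * (u \<bullet> d) + w\<^sup>2 * (u \<bullet> u)"
    by (simp add: inner_diff_left inner_diff_right inner_commute power2_eq_square algebra_simps)
  ultimately have "(d - w *\<^sub>R u) \<bullet> (d - w *\<^sub>R u) \<le> 0"
    using assms(2) by (simp add: power2_eq_square)
  then have "d - w *\<^sub>R u = 0" using inner_gt_zero_iff[of "d - w *\<^sub>R u"] by linarith
  then show ?thesis by simp
qed

section \<open>Support points of a body of constant width\<close>

locale constant_width_body =
  fixes C :: "(real^2) set" and w :: real
  assumes body: "convex_body C" and width: "constant_width w C"
begin

lemma compact_C: "compact C" and convex_C: "convex C" and interior_C: "interior C \<noteq> {}"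
  using body by (auto simp: convex_body_def)

lemma closed_C: "closed C"
  using compact_C by (rule compact_imp_closed)

text \<open>The choice is harmless: the point of contact turns out to be unique (\<open>supp_pt_unique\<close>).\<close>

definition supp_pt :: "real \<Rightarrow> real^2" where
  "supp_pt \<theta> = (SOME p. p \<in> C \<and> (\<forall>q\<in>C. dir \<theta> \<bullet> q \<le> dir \<theta> \<bullet> p))"

lemma supp_pt: "supp_pt \<theta> \<in> C" "q \<in> C \<Longrightarrow> dir \<theta> \<bullet> q \<le> dir \<theta> \<bullet> supp_pt \<theta>"
proof -
  have "C \<noteq> {}" using interior_C interior_subset by blast
  moreover have "continuous_on C (\<lambda>q. dir \<theta> \<bullet> q)" by (intro continuous_intros)
  ultimately have "\<exists>p. p \<in> C \<and> (\<forall>q\<in>C. dir \<theta> \<bullet> q \<le> dir \<theta> \<bullet> p)"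
    using continuous_attains_sup[OF compact_C] by (metis (no_types, lifting))
  from someI_ex[OF this] show "supp_pt \<theta> \<in> C" "q \<in> C \<Longrightarrow> dir \<theta> \<bullet> q \<le> dir \<theta> \<bullet> supp_pt \<theta>"
    unfolding supp_pt_def by auto
qed

lemma width_in_direction:
  "0 < w \<and> dir \<theta> \<bullet> (supp_pt \<theta> - supp_pt (\<theta> + pi)) = w"
proof -
  define p where "p = supp_pt \<theta>"
  define q where "q = supp_pt (\<theta> + pi)"
  define d where "d = dir \<theta> \<bullet> (p - q)"
  define L where "L = {y. dir \<theta> \<bullet> y = dir \<theta> \<bullet> p}"
  define L' where "L' = {y. (- dir \<theta>) \<bullet> y = (- dir \<theta>) \<bullet> q}"
  have hi: "dir \<theta> \<bullet> y \<le> dir \<theta> \<bullet> p" if "y \<in> C" for y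
    using supp_pt(2)[OF that, of \<theta>] by (simp add: p_def)
  have lo: "dir \<theta> \<bullet> q \<le> dir \<theta> \<bullet> y" if "y \<in> C" for y
    using supp_pt(2)[OF that, of "\<theta> + pi"] by (simp add: q_def dir_add_pi)
  have pC: "p \<in> C" "q \<in> C" using supp_pt by (auto simp: p_def q_def)
  have uu: "dir \<theta> \<bullet> dir \<theta> = 1" by (simp add: inner_dir)
  obtain o' e where e: "e > 0" "ball o' e \<subseteq> C"
    using interior_C by (meson ex_in_conv mem_interior)
  have "o' + (e/2) *\<^sub>R dir \<theta> \<in> ball o' e" "o' \<in> ball o' e"
    using e(1) by (auto simp: dist_norm)
  then have "dir \<theta> \<bullet> (o' + (e/2) *\<^sub>R dir \<theta>) \<le> dir \<theta> \<bullet> p" "dir \<theta> \<bullet> q \<le> dir \<theta> \<bullet> o'"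
    using e(2) hi lo by blast+
  then have dpos: "d > 0"
    using e(1) by (simp add: d_def inner_add_right inner_diff_right uu)
  have "supporting_line C L"
    unfolding supporting_line_def L_def using hi pC
    by (intro exI[of _ "dir \<theta>"] exI[of _ "dir \<theta> \<bullet> p"]) auto
  moreover have "supporting_line C L'"
    unfolding supporting_line_def L'_def using lo pC
    by (intro exI[of _ "- dir \<theta>"] exI[of _ "(- dir \<theta>) \<bullet> q"]) auto
  moreover have "L \<noteq> L'"
  proof -
    have "p \<in> L" "p \<notin> L'" using dpos by (auto simp: L_def L'_def d_def inner_diff_right)
    then show ?thesis by blast
  qed
  moreover have "affine_parallel L L'"
    unfolding affine_parallel_def
  proof (intro exI[of _ "- d *\<^sub>R dir \<theta>"] set_eqI iffI)
    fix y assume "y \<in> L'"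
    then have "y + d *\<^sub>R dir \<theta> \<in> L"
      by (simp add: L_def L'_def d_def inner_add_right inner_diff_right uu)
    then show "y \<in> (+) (- d *\<^sub>R dir \<theta>) ` L"
      by (intro image_eqI[of _ _ "y + d *\<^sub>R dir \<theta>"]) auto
  next
    fix y assume "y \<in> (+) (- d *\<^sub>R dir \<theta>) ` L"
    then show "y \<in> L'"
      by (auto simp: L_def L'_def d_def inner_add_right inner_diff_right uu)
  qed
  ultimately have "setdist L L' = w"
    using width unfolding constant_width_def by blast
  moreover have "setdist L L' = dist p (p - d *\<^sub>R dir \<theta>)"
  proof (rule setdist_unique)
    show "p \<in> L" by (simp add: L_def)
    show "p - d *\<^sub>R dir \<theta> \<in> L'" by (simp add: L'_def d_def inner_diff_right uu)
    fix y y' assume "y \<in> L \<and> y' \<in> L'"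
    then have "dir \<theta> \<bullet> (y - y') = d" by (simp add: L_def L'_def d_def inner_diff_right)
    moreover have "dir \<theta> \<bullet> (y - y') \<le> norm (dir \<theta>) * norm (y - y')"
      by (rule norm_cauchy_schwarz)
    ultimately show "dist p (p - d *\<^sub>R dir \<theta>) \<le> dist y y'"
      using dpos by (simp add: dist_norm)
  qed
  ultimately have "d = w" using dpos by (simp add: dist_norm)
  then show ?thesis using dpos by (simp add: d_def p_def q_def)
qed

lemma width_pos: "0 < w"
  using width_in_direction by blast

text \<open>The two supporting lines perpendicular to \<open>p - q\<close> enclose both points.\<close>

lemma dist_le_width:
  assumes "p \<in> C" "q \<in> C"
  shows "dist p q \<le> w"
proof (cases "p = q")
  case True then show ?thesis using width_pos by simp
next
  case False
  define v where "v = (p - q) /\<^sub>R norm (p - q)"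
  have "norm v = 1" using False by (simp add: v_def)
  then obtain \<theta> where t: "v = dir \<theta>" by (rule unit_vector_dir)
  have "dist p q = v \<bullet> (p - q)"
    using False by (simp add: v_def dist_norm power2_norm_eq_inner[symmetric] power2_eq_square)
  also have "\<dots> \<le> dir \<theta> \<bullet> (supp_pt \<theta> - supp_pt (\<theta> + pi))"
    using supp_pt(2)[OF assms(1), of \<theta>] supp_pt(2)[OF assms(2), of "\<theta> + pi"]
    by (simp add: t inner_diff_right dir_add_pi)
  finally show ?thesis using width_in_direction[of \<theta>] by simp
qed

lemma opposite: "supp_pt \<theta> = supp_pt (\<theta> + pi) + w *\<^sub>R dir \<theta>"
proof -
  have "supp_pt \<theta> - supp_pt (\<theta> + pi) = w *\<^sub>R dir \<theta>"
    using width_in_direction[of \<theta>] dist_le_width[OF supp_pt(1) supp_pt(1)]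
    by (intro unit_vector_from_inner) (auto simp: dist_norm)
  then show ?thesis by (simp add: algebra_simps)
qed

text \<open>Both any point of contact in direction \<open>\<theta>\<close> and the chosen one are the translate by
  \<open>w dir \<theta>\<close> of the chosen point of contact on the opposite side, so the contact is at one point.\<close>

lemma supp_pt_unique:
  assumes "p \<in> C" "dir \<theta> \<bullet> supp_pt \<theta> \<le> dir \<theta> \<bullet> p"
  shows "p = supp_pt \<theta>"
proof -
  have "dir \<theta> \<bullet> p = dir \<theta> \<bullet> supp_pt \<theta>"
    using supp_pt(2)[OF assms(1), of \<theta>] assms(2) by simp
  then have "p - supp_pt (\<theta> + pi) = w *\<^sub>R dir \<theta>"
    using width_in_direction[of \<theta>] dist_le_width[OF assms(1) supp_pt(1)]
    by (intro unit_vector_from_inner) (auto simp: dist_norm inner_diff_right)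
  then show ?thesis using opposite[of \<theta>] by (simp add: algebra_simps)
qed

text \<open>Two points at distance \<open>w\<close> lie on the two supporting lines perpendicular to their difference,
  as the strip between these lines has width only \<open>w\<close>.\<close>

lemma diametral_pair:
  assumes "p \<in> C" "q \<in> C" "dist p q = w"
  obtains \<theta> where "p = supp_pt \<theta>" "q = supp_pt (\<theta> + pi)"
proof -
  define v where "v = (p - q) /\<^sub>R w"
  have nv: "norm v = 1" using assms(3) width_pos by (simp add: v_def dist_norm)
  then obtain \<theta> where t: "v = dir \<theta>" by (rule unit_vector_dir)
  have "w *\<^sub>R v = p - q" using width_pos by (simp add: v_def)
  then have "p - q = w *\<^sub>R dir \<theta>" by (simp add: t)
  then have "dir \<theta> \<bullet> (p - q) = w" by (simp add: inner_dir)
  then have "dir \<theta> \<bullet> (p - q) = dir \<theta> \<bullet> (supp_pt \<theta> - supp_pt (\<theta> + pi))"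
    using width_in_direction[of \<theta>] by simp
  then have "dir \<theta> \<bullet> supp_pt \<theta> \<le> dir \<theta> \<bullet> p"
    "dir (\<theta> + pi) \<bullet> supp_pt (\<theta> + pi) \<le> dir (\<theta> + pi) \<bullet> q"
    using supp_pt(2)[OF assms(1), of \<theta>] supp_pt(2)[OF assms(2), of "\<theta> + pi"]
    by (auto simp: inner_diff_right dir_add_pi)
  then show thesis using assms supp_pt_unique that by blast
qed

lemma dist_opposite: "dist (supp_pt \<theta>) (supp_pt (\<theta> + pi)) = w"
  using opposite[of \<theta>] width_pos by (simp add: dist_norm)

lemma diameter_eq_width: "diameter C = w"
proof (rule antisym)
  have "C \<noteq> {}" using supp_pt by blast
  then show "diameter C \<le> w"
    using diameter_compact_attained[OF compact_C] dist_le_width by metis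
  show "w \<le> diameter C"
    using diameter_bounded_bound[OF compact_imp_bounded[OF compact_C] supp_pt(1) supp_pt(1)]
      dist_opposite[of 0] by metis
qed

lemma supp_pt_in_frontier: "supp_pt \<theta> \<in> frontier C"
proof -
  have "supp_pt \<theta> \<notin> interior C"
  proof
    assume "supp_pt \<theta> \<in> interior C"
    then obtain e where e: "e > 0" "ball (supp_pt \<theta>) e \<subseteq> C"
      by (meson mem_interior)
    have "supp_pt \<theta> + (e/2) *\<^sub>R dir \<theta> \<in> C"
      using e by (intro subsetD[OF e(2)]) (auto simp: dist_norm)
    from supp_pt(2)[OF this, of \<theta>] show False
      using e(1) by (simp add: inner_add_right inner_dir)
  qed
  then show ?thesis
    using supp_pt(1) closed_C by (simp add: frontier_def)
qed

lemma frontier_eq_range: "frontier C = range supp_pt"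
proof
  show "range supp_pt \<subseteq> frontier C" using supp_pt_in_frontier by blast
  show "frontier C \<subseteq> range supp_pt"
  proof
    fix p assume "p \<in> frontier C"
    then have p: "p \<in> closure C" "p \<notin> rel_interior C" "p \<in> C"
      using closed_C rel_interior_nonempty_interior[OF interior_C] by (auto simp: frontier_def)
    obtain a where a: "a \<noteq> 0" "\<And>y. y \<in> closure C \<Longrightarrow> a \<bullet> p \<le> a \<bullet> y"
      using supporting_hyperplane_relative_frontier[OF convex_C p(1,2)] by metis
    obtain \<theta> where t: "- (a /\<^sub>R norm a) = dir \<theta>"
      using unit_vector_dir[of "- (a /\<^sub>R norm a)"] a(1) by auto
    have "(a /\<^sub>R norm a) \<bullet> p \<le> (a /\<^sub>R norm a) \<bullet> supp_pt \<theta>"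
      using a(2)[of "supp_pt \<theta>"] supp_pt(1)[of \<theta>] closure_subset[of C] a(1)
      by (auto simp: divide_right_mono intro!: mult_left_mono)
    then have "dir \<theta> \<bullet> supp_pt \<theta> \<le> dir \<theta> \<bullet> p"
      unfolding t[symmetric] by simp
    with p(3) show "p \<in> range supp_pt" using supp_pt_unique by blast
  qed
qed

text \<open>By uniqueness the graph is described by weak inequalities between continuous functions, hence it
  is closed; the values stay in a compact set.\<close>

lemma continuous_on_supp_pt: "continuous_on S supp_pt"
proof -
  have "closed (range (\<lambda>\<theta>. (\<theta>, supp_pt \<theta>)))"
  proof -
    have "range (\<lambda>\<theta>. (\<theta>, supp_pt \<theta>))
        = UNIV \<times> C \<inter> (\<Inter>q\<in>C. {z. dir (fst z) \<bullet> q \<le> dir (fst z) \<bullet> snd z})"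
    proof (intro subset_antisym subsetI)
      fix z assume "z \<in> range (\<lambda>\<theta>. (\<theta>, supp_pt \<theta>))"
      then show "z \<in> UNIV \<times> C \<inter> (\<Inter>q\<in>C. {z. dir (fst z) \<bullet> q \<le> dir (fst z) \<bullet> snd z})"
        by (auto simp: supp_pt)
    next
      fix z assume z: "z \<in> UNIV \<times> C \<inter> (\<Inter>q\<in>C. {z. dir (fst z) \<bullet> q \<le> dir (fst z) \<bullet> snd z})"
      then have "snd z \<in> C" "dir (fst z) \<bullet> supp_pt (fst z) \<le> dir (fst z) \<bullet> snd z"
        using supp_pt(1)[of "fst z"] by auto
      from supp_pt_unique[OF this] show "z \<in> range (\<lambda>\<theta>. (\<theta>, supp_pt \<theta>))"
        by (metis prod.collapse rangeI)
    qed
    moreover have "closed {z::real \<times> (real^2). dir (fst z) \<bullet> q \<le> dir (fst z) \<bullet> snd z}" for q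
    proof -
      have "continuous_on UNIV (\<lambda>z::real \<times> (real^2). dir (fst z))"
        by (rule continuous_on_compose2[OF continuous_on_dir[of UNIV]]) (auto intro: continuous_intros)
      then show ?thesis
        by (intro closed_Collect_le continuous_on_inner continuous_on_snd continuous_on_id
            continuous_on_const)
    qed
    ultimately show ?thesis
      using closed_C by (auto intro!: closed_Int closed_Times closed_INT)
  qed
  then have "continuous_on UNIV supp_pt"
    using supp_pt(1) by (intro continuous_from_closed_graph[OF compact_C]) auto
  then show ?thesis using continuous_on_subset by blast
qed

lemma supp_pt_cong_dir:
  assumes "dir a = dir b" shows "supp_pt a = supp_pt b"
  unfolding supp_pt_def assms by simp

lemma supp_pt_turns: "supp_pt (\<theta> + 2 * pi * of_int q) = supp_pt \<theta>"
  by (rule supp_pt_cong_dir) (rule dir_plus_turns)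

lemma supp_pt_turn: "supp_pt (\<theta> + 2 * pi) = supp_pt \<theta>" "supp_pt (\<theta> - pi) = supp_pt (\<theta> + pi)"
  using supp_pt_turns[of \<theta> 1] supp_pt_turns[of "\<theta> - pi" 1] by (simp_all add: algebra_simps)

lemma supp_pt_opposite_neq: "supp_pt \<theta> \<noteq> supp_pt (\<theta> + pi)"
  using dist_opposite[of \<theta>] width_pos by auto

text \<open>A direction between two normals of a boundary point is a nonnegative combination of them, so the
  functional that it defines is also maximal at this point.\<close>

lemma normal_cone_convex:
  assumes "a \<le> c" "c \<le> b" "b < a + pi" "supp_pt a = supp_pt b"
  shows "supp_pt c = supp_pt a"
proof (cases "a < b")
  case False
  then have "c = a" using assms(1,2) by simp
  then show ?thesis by simp
next
  case True
  define p where "p = supp_pt a"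
  define q where "q = supp_pt c"
  have s: "sin (b - a) > 0" "sin (b - c) \<ge> 0" "sin (c - a) \<ge> 0"
    using assms True by (auto intro!: sin_gt_zero sin_ge_zero)
  have "sin (b - c) * (dir a \<bullet> (p - q)) \<ge> 0" "sin (c - a) * (dir b \<bullet> (p - q)) \<ge> 0"
    using s supp_pt(2)[of q a] supp_pt(2)[of q b] assms(4) supp_pt(1)
    by (auto simp: p_def q_def inner_diff_right)
  then have "(sin (b - a) *\<^sub>R dir c) \<bullet> (p - q) \<ge> 0"
    unfolding dir_between[of b a c] by (simp add: inner_add_left)
  then have "dir c \<bullet> (p - q) \<ge> 0" using s(1) by (simp add: zero_le_mult_iff)
  then have "dir c \<bullet> supp_pt c \<le> dir c \<bullet> p" by (simp add: inner_diff_right q_def)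
  then show ?thesis using supp_pt_unique[of p c] supp_pt(1) by (simp add: p_def)
qed

text \<open>Opposite directions have different support points, so some representative modulo full turns of
  \<open>b\<close> differs from \<open>a\<close> by less than a half turn, as \<open>normal_cone_convex\<close> requires.\<close>

lemma same_supp_pt_near:
  assumes "supp_pt a = supp_pt b"
  obtains q :: int where "a - pi < b + 2 * pi * of_int q" "b + 2 * pi * of_int q < a + pi"
proof -
  define q where "q = \<lfloor>(a + pi - b) / (2 * pi)\<rfloor>"
  have "of_int q \<le> (a + pi - b) / (2 * pi)" "(a + pi - b) / (2 * pi) < of_int q + 1"
    unfolding q_def by linarith+
  then have 1: "b + 2 * pi * of_int q \<le> a + pi" "a - pi < b + 2 * pi * of_int q"
    by (auto simp: field_simps)
  moreover have "b + 2 * pi * of_int q \<noteq> a + pi"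
    using assms supp_pt_turns[of b q] supp_pt_opposite_neq[of a] by metis
  ultimately show thesis by (intro that[of q]) auto
qed

text \<open>The difference of opposite support points determines their direction. In particular no vertex is
  opposite to a vertex on a whole interval of directions.\<close>

lemma not_both_constant:
  assumes "a < b" "b < a + 2 * pi" "supp_pt a = supp_pt b"
  shows "supp_pt (a + pi) \<noteq> supp_pt (b + pi)"
  using assms opposite[of a] opposite[of b] dir_neq[of a b] width_pos by auto

end

section \<open>Covers of a body of constant width\<close>

definition borsuk_coverable :: "nat \<Rightarrow> 'a::metric_space set \<Rightarrow> nat \<Rightarrow> bool" where
  "borsuk_coverable k S m \<longleftrightarrow>
     (\<exists>F. kfold_cover k S m F \<and> (\<forall>i<m. bounded (F i) \<and> diameter (F i) < diameter S))"

lemma kfold_borsuk_number_eqI: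
  assumes "borsuk_coverable k S m" "0 < m" "\<And>m'. borsuk_coverable k S m' \<Longrightarrow> m \<le> m'"
  shows "kfold_borsuk_number k S = m"
  unfolding kfold_borsuk_number_def borsuk_coverable_def[symmetric]
  using assms by (intro Least_equality) auto

lemma borsuk_coverable_add:
  assumes "borsuk_coverable k S m" "borsuk_coverable k' S m'"
  shows "borsuk_coverable (k + k') S (m + m')"
proof -
  obtain F where F: "kfold_cover k S m F" "\<And>i. i < m \<Longrightarrow> bounded (F i) \<and> diameter (F i) < diameter S"
    using assms(1) unfolding borsuk_coverable_def by blast
  obtain G where G: "kfold_cover k' S m' G" "\<And>i. i < m' \<Longrightarrow> bounded (G i) \<and> diameter (G i) < diameter S"
    using assms(2) unfolding borsuk_coverable_def by blast
  define H where "H i = (if i < m then F i else G (i - m))" for i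
  have "k + k' \<le> card {i. i < m + m' \<and> x \<in> H i}" if "x \<in> S" for x
  proof -
    have "{i. i < m + m' \<and> x \<in> H i} = {i. i < m \<and> x \<in> F i} \<union> (\<lambda>i. i + m) ` {i. i < m' \<and> x \<in> G i}"
    proof (rule set_eqI)
      fix i
      show "i \<in> {i. i < m + m' \<and> x \<in> H i} \<longleftrightarrow>
          i \<in> {i. i < m \<and> x \<in> F i} \<union> (\<lambda>i. i + m) ` {i. i < m' \<and> x \<in> G i}"
      proof (cases "i < m")
        case True
        then show ?thesis by (auto simp: H_def)
      next
        case False
        then have "i \<in> (\<lambda>i. i + m) ` A \<longleftrightarrow> i - m \<in> A" for A
          by (auto simp: image_iff) (metis le_add_diff_inverse2 not_less)
        then show ?thesis using False by (auto simp: H_def)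
      qed
    qed
    moreover have "card (\<dots>) = card {i. i < m \<and> x \<in> F i} + card ((\<lambda>i. i + m) ` {i. i < m' \<and> x \<in> G i})"
      by (rule card_Un_disjoint) auto
    moreover have "card ((\<lambda>i. i + m) ` {i. i < m' \<and> x \<in> G i}) = card {i. i < m' \<and> x \<in> G i}"
      by (intro card_image inj_onI) simp
    ultimately show ?thesis
      using F(1) G(1) that unfolding kfold_cover_def by (simp add: add_mono)
  qed
  moreover have "bounded (H i) \<and> diameter (H i) < diameter S" if "i < m + m'" for i
    using F(2)[of i] G(2)[of "i - m"] that by (auto simp: H_def)
  ultimately show ?thesis
    unfolding borsuk_coverable_def kfold_cover_def by blast
qed

context constant_width_body
begin

text \<open>Opposite support points lie in no common member, so with at most \<open>2 k\<close> members the index sets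
  of two opposite points are complementary. Hence each member, made closed, meets the boundary
  circle in an open and closed set, and by connectedness in nothing or everything; the latter is
  impossible as a member contains no two opposite points.\<close>

lemma borsuk_lower_bound:
  assumes "borsuk_coverable k C m" "k \<ge> 1"
  shows "2 * k + 1 \<le> m"
proof (rule ccontr)
  assume "\<not> 2 * k + 1 \<le> m"
  then have m: "m \<le> 2 * k" by simp
  obtain F where F: "kfold_cover k C m F" "\<And>i. i < m \<Longrightarrow> bounded (F i) \<and> diameter (F i) < w"
    using assms(1) unfolding borsuk_coverable_def diameter_eq_width by blast
  define I where "I \<theta> = {i. i < m \<and> supp_pt \<theta> \<in> closure (F i)}" for \<theta>
  have disj: "I \<theta> \<inter> I (\<theta> + pi) = {}" for \<theta>
  proof -
    have False if "i \<in> I \<theta>" "i \<in> I (\<theta> + pi)" for i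
    proof -
      have i: "i < m" and "supp_pt \<theta> \<in> closure (F i)" "supp_pt (\<theta> + pi) \<in> closure (F i)"
        using that by (auto simp: I_def)
      then have "dist (supp_pt \<theta>) (supp_pt (\<theta> + pi)) \<le> diameter (closure (F i))"
        using F(2)[OF i] by (intro diameter_bounded_bound) auto
      then show False using dist_opposite[of \<theta>] F(2)[OF i] by (simp add: diameter_closure)
    qed
    then show ?thesis by blast
  qed
  have card: "k \<le> card (I \<theta>)" for \<theta>
  proof -
    have "k \<le> card {i. i < m \<and> supp_pt \<theta> \<in> F i}"
      using F(1) supp_pt(1) unfolding kfold_cover_def by blast
    also have "\<dots> \<le> card (I \<theta>)"
      unfolding I_def using closure_subset by (intro card_mono) auto
    finally show ?thesis .
  qed
  have compl: "I \<theta> \<union> I (\<theta> + pi) = {..<m}" for \<theta>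
  proof (rule card_subset_eq)
    have fin: "finite (I \<theta>)" for \<theta> by (simp add: I_def)
    have "card (I \<theta> \<union> I (\<theta> + pi)) = card (I \<theta>) + card (I (\<theta> + pi))"
      using fin disj by (intro card_Un_disjoint) auto
    moreover have "card (I \<theta> \<union> I (\<theta> + pi)) \<le> card {..<m}"
      by (intro card_mono) (auto simp: I_def)
    ultimately show "card (I \<theta> \<union> I (\<theta> + pi)) = card {..<m}"
      using card[of \<theta>] card[of "\<theta> + pi"] m by simp
  qed (auto simp: I_def)
  obtain i where i: "i \<in> I 0"
    using card[of 0] assms(2) by (metis card.empty ex_in_conv not_one_le_zero le_trans)
  define D where "D = {\<theta>. supp_pt \<theta> \<in> closure (F i)}"
  have im: "i < m" using i by (simp add: I_def)
  have "closed D"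
    unfolding D_def using continuous_on_supp_pt[of UNIV]
    by (simp add: continuous_closed_vimage closed_vimage[unfolded vimage_def])
  moreover have "- D = {\<theta>. supp_pt (\<theta> + pi) \<in> closure (F i)}"
    using disj compl im by (fastforce simp: D_def I_def)
  then have "closed (- D)"
    using closed_vimage[OF closed_closure continuous_on_compose2[OF continuous_on_supp_pt[of UNIV], of UNIV "\<lambda>\<theta>. \<theta> + pi"], of "F i"]
    by (simp add: vimage_def continuous_intros)
  moreover have "0 \<in> D" using i by (simp add: D_def I_def)
  ultimately have "D = UNIV"
    using clopen[of D] by (auto simp: open_closed)
  then have "supp_pt 0 \<in> closure (F i)" "supp_pt (0 + pi) \<in> closure (F i)"
    unfolding D_def by blast+
  then have "i \<in> I 0 \<inter> I (0 + pi)" using im unfolding I_def by blast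
  then show False using disj by blast
qed

text \<open>Each normal of a point of the arc lies strictly between \<open>l'\<close> and \<open>l' + pi\<close> up to full turns,
  so no two points of the arc have opposite normals.\<close>

lemma arc_without_diametral_pair:
  assumes "l' < l" "r < l' + pi" "supp_pt l' \<noteq> supp_pt l" "supp_pt r \<noteq> supp_pt (l' + pi)"
    and "\<alpha> \<in> {l..r}" "\<beta> \<in> {l..r}"
  shows "dist (supp_pt \<alpha>) (supp_pt \<beta>) < w"
proof -
  have near: "\<exists>q::int. l' < \<theta> + 2 * pi * q \<and> \<theta> + 2 * pi * q < l' + pi"
    if g: "\<gamma> \<in> {l..r}" "supp_pt \<theta> = supp_pt \<gamma>" for \<gamma> \<theta>
  proof -
    obtain q :: int where q: "\<gamma> - pi < \<theta> + 2 * pi * q" "\<theta> + 2 * pi * q < \<gamma> + pi"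
      using same_supp_pt_near[of \<gamma> \<theta>] g(2) by metis
    define \<phi> where "\<phi> = \<theta> + 2 * pi * of_int q"
    have e: "supp_pt \<phi> = supp_pt \<gamma>" by (simp add: \<phi>_def supp_pt_turns g(2))
    have "l' < \<phi>"
    proof (rule ccontr)
      assume "\<not> l' < \<phi>"
      then have "\<phi> \<le> l'" "l \<le> \<gamma>" "\<gamma> < \<phi> + pi" using q(1) g(1) by (auto simp: \<phi>_def)
      then have "supp_pt l' = supp_pt \<phi>" "supp_pt l = supp_pt \<phi>"
        using assms(1) by (auto intro: normal_cone_convex[OF _ _ _ e])
      then show False using assms(3) by simp
    qed
    moreover have "\<phi> < l' + pi"
    proof (rule ccontr)
      assume "\<not> \<phi> < l' + pi"
      then have "l' + pi \<le> \<phi>" "\<gamma> \<le> r" "\<phi> < \<gamma> + pi" using q(2) g(1) by (auto simp: \<phi>_def)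
      then have "supp_pt (l' + pi) = supp_pt \<gamma>" "supp_pt r = supp_pt \<gamma>"
        using assms(2) by (auto intro: normal_cone_convex[OF _ _ _ e[symmetric]])
      then show False using assms(4) by simp
    qed
    ultimately show ?thesis unfolding \<phi>_def by blast
  qed
  show ?thesis
  proof (rule ccontr)
    assume "\<not> ?thesis"
    then have "dist (supp_pt \<alpha>) (supp_pt \<beta>) = w"
      using dist_le_width[OF supp_pt(1) supp_pt(1)] by (metis less_eq_real_def)
    then obtain \<theta> where t: "supp_pt \<alpha> = supp_pt \<theta>" "supp_pt \<beta> = supp_pt (\<theta> + pi)"
      using diametral_pair[OF supp_pt(1) supp_pt(1)] by metis
    obtain q q' :: int where "l' < \<theta> + 2 * pi * q" "\<theta> + 2 * pi * q < l' + pi"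
      "l' < \<theta> + pi + 2 * pi * q'" "\<theta> + pi + 2 * pi * q' < l' + pi"
      using near[OF assms(5), of \<theta>] near[OF assms(6), of "\<theta> + pi"] t by metis
    then have "pi * real_of_int q' < pi * of_int q" "pi * real_of_int q < pi * of_int (q' + 1)"
      by (auto simp only: algebra_simps of_int_add of_int_1 mult_1_right)
    then have "q' < q" "q < q' + 1" by (simp_all only: mult_less_cancel_left_pos[OF pi_gt_zero] of_int_less_iff)
    then show False by simp
  qed
qed

text \<open>Coning a piece of the boundary to a fixed interior point creates no diametral pair, because
  diametral points are boundary points and the interiors of the segments consist of interior points.\<close>

lemma cone_extension:
  assumes G: "\<And>i. i < m \<Longrightarrow> compact (G i) \<and> G i \<noteq> {} \<and> G i \<subseteq> frontier C"
    and small: "\<And>i p q. i < m \<Longrightarrow> p \<in> G i \<Longrightarrow> q \<in> G i \<Longrightarrow> dist p q < w"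
    and cover: "\<And>\<theta>. k \<le> card {i. i < m \<and> supp_pt \<theta> \<in> G i}"
  shows "borsuk_coverable k C m"
proof -
  obtain c where c: "c \<in> interior C" using interior_C by blast
  define h where "h = (\<lambda>z::real \<times> (real^2). c + fst z *\<^sub>R (snd z - c))"
  define F where "F i = h ` ({0..1} \<times> G i)" for i
  have FI: "c + t *\<^sub>R (p - c) \<in> F i" if "0 \<le> t" "t \<le> 1" "p \<in> G i" for t p i
    unfolding F_def h_def using that by (intro image_eqI[of _ _ "(t, p)"]) auto
  have cpt: "compact (F i)" if "i < m" for i
    unfolding F_def h_def using G[OF that]
    by (intro compact_continuous_image compact_Times continuous_intros) auto
  have GC: "G i \<subseteq> C" if "i < m" for i
    using G[OF that] frontier_subset_closed[OF closed_C] by blast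
  have seg: "c + t *\<^sub>R (p - c) \<in> interior C" if "p \<in> C" "0 \<le> t" "t < 1" for t p
  proof -
    have "p - (1 - t) *\<^sub>R (p - c) \<in> interior C"
      using that by (intro mem_interior_convex_shrink[OF convex_C c]) auto
    then show ?thesis by (simp add: algebra_simps)
  qed
  have FG: "y \<in> G i" if iy: "i < m" "y \<in> F i" "y \<notin> interior C" for y i
  proof -
    obtain t p where tp: "0 \<le> t" "t \<le> 1" "p \<in> G i" "y = c + t *\<^sub>R (p - c)"
      using iy(2) unfolding F_def h_def by auto
    then have "t = 1" using seg[of p t] GC[OF iy(1)] iy(3) by fastforce
    then show ?thesis using tp by simp
  qed
  have FC: "F i \<subseteq> C" if "i < m" for i
  proof
    fix y assume y: "y \<in> F i"
    show "y \<in> C"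
    proof (cases "y \<in> interior C")
      case True then show ?thesis using interior_subset by blast
    next
      case False then show ?thesis using FG[OF that y] GC[OF that] by blast
    qed
  qed
  have "bounded (F i) \<and> diameter (F i) < diameter C" if i: "i < m" for i
  proof
    show "bounded (F i)" using cpt[OF i] by (rule compact_imp_bounded)
    have "F i \<noteq> {}" using G[OF i] by (auto simp: F_def)
    then obtain y y' where y: "y \<in> F i" "y' \<in> F i" "dist y y' = diameter (F i)"
      using diameter_compact_attained[OF cpt[OF i]] by blast
    have "dist y y' \<noteq> w"
    proof
      assume "dist y y' = w"
      then obtain \<theta> where "y = supp_pt \<theta>" "y' = supp_pt (\<theta> + pi)"
        using diametral_pair y FC[OF i] by blast
      then have "y \<notin> interior C" "y' \<notin> interior C"
        using supp_pt_in_frontier by (auto simp: frontier_def)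
      then have "dist y y' < w" using FG[OF i] y small[OF i] by blast
      then show False using \<open>dist y y' = w\<close> by simp
    qed
    moreover have "dist y y' \<le> w" using dist_le_width y FC[OF i] by blast
    ultimately show "diameter (F i) < diameter C"
      using y(3) diameter_eq_width by simp
  qed
  moreover have "k \<le> card {i. i < m \<and> y \<in> F i}" if y: "y \<in> C" for y
  proof -
    obtain \<theta> t where t: "0 \<le> t" "t \<le> 1" "y = c + t *\<^sub>R (supp_pt \<theta> - c)"
    proof (cases "y = c")
      case True then show thesis by (intro that[of 0]) auto
    next
      case False
      then obtain d where d: "0 < d" "c + d *\<^sub>R (y - c) \<in> frontier C"
        using ray_to_frontier[OF compact_imp_bounded[OF compact_C] c, of "y - c"] by auto
      have "1 \<le> d"
      proof (rule ccontr)
        assume "\<not> 1 \<le> d"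
        then have "c + d *\<^sub>R (y - c) \<in> interior C" using seg[OF y, of d] d(1) by simp
        then show False using d(2) by (simp add: frontier_def)
      qed
      obtain \<theta> where "c + d *\<^sub>R (y - c) = supp_pt \<theta>"
        using d(2) frontier_eq_range by auto
      then have "(1 / d) *\<^sub>R (supp_pt \<theta> - c) = (1 / d) *\<^sub>R (d *\<^sub>R (y - c))"
        by (metis add_diff_cancel_left')
      then have "y = c + (1 / d) *\<^sub>R (supp_pt \<theta> - c)" using d(1) by simp
      then show thesis using \<open>1 \<le> d\<close> by (intro that[of "1 / d"]) auto
    qed
    have "k \<le> card {i. i < m \<and> supp_pt \<theta> \<in> G i}" by (rule cover)
    also have "\<dots> \<le> card {i. i < m \<and> y \<in> F i}"
      using FI t by (intro card_mono) auto
    finally show ?thesis .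
  qed
  ultimately show ?thesis
    unfolding borsuk_coverable_def kfold_cover_def by blast
qed

end

section \<open>Increasing sequences that advance by a fixed period\<close>

lemma periodic_extension:
  fixes f :: "nat \<Rightarrow> real"
  assumes N: "0 < N" and mono: "\<And>i j. i < j \<Longrightarrow> j < N \<Longrightarrow> f i < f j" and last: "f (N - 1) < f 0 + p"
  shows "\<exists>e :: int \<Rightarrow> real. strict_mono e \<and> (\<forall>j. e (j + int N) = e j + p) \<and>
    (\<forall>q. \<forall>r<N. e (q * int N + int r) = f r + p * of_int q)"
proof -
  define e where "e j = f (nat (j mod int N)) + p * of_int (j div int N)" for j
  have base: "e (q * int N + int r) = f r + p * of_int q" if "r < N" for q r
    using that by (simp add: e_def)
  have step: "e j < e (j + 1)" for j
  proof -
    define q where "q = j div int N"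
    define r where "r = nat (j mod int N)"
    have r: "r < N" and j: "j = q * int N + int r"
      using N by (auto simp: q_def r_def nat_less_iff)
    show ?thesis
    proof (cases "Suc r < N")
      case True
      then have "e (j + 1) = f (Suc r) + p * of_int q"
        using base[of "Suc r" q] by (simp add: j algebra_simps)
      then show ?thesis using base[OF r, of q] mono[of r "Suc r"] True by (simp add: j)
    next
      case False
      then have rN: "r = N - 1" "j + 1 = (q + 1) * int N + int 0"
        using r by (auto simp: j algebra_simps)
      then have "e (j + 1) = f 0 + p * (of_int q + 1)"
        using base[OF N, of "q + 1"] by simp
      then show ?thesis using base[OF r, of q] last rN(1) by (simp add: j algebra_simps)
    qed
  qed
  have "e i < e j" if "i < j" for i j
    using that
  proof (induction rule: int_gr_induct)
    case base then show ?case by (rule step)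
  next
    case (step k) then show ?case using \<open>\<And>j. e j < e (j + 1)\<close>[of k] by simp
  qed
  then have "strict_mono e" by (simp add: strict_mono_def)
  moreover have "e (j + int N) = e j + p" for j
    using N by (simp add: e_def algebra_simps)
  ultimately show ?thesis using base by blast
qed

lemma period_multiple:
  fixes e :: "int \<Rightarrow> real"
  assumes "\<And>j. e (j + N) = e j + p"
  shows "e (j + N * q) = e j + p * of_int q"
proof (induction q rule: int_induct[of _ 0])
  case (step1 i)
  then show ?case using assms[of "j + N * i"] by (simp add: algebra_simps)
next
  case (step2 i)
  then show ?case using assms[of "j + N * (i - 1)"] by (simp add: algebra_simps)
qed simp

lemma locate_in_sequence:
  fixes e :: "int \<Rightarrow> real"
  assumes "strict_mono e" "0 < p" "0 < N" "\<And>j. e (j + N) = e j + p"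
  obtains j where "e j \<le> \<theta>" "\<theta> < e (j + 1)"
proof -
  define q where "q = \<lfloor>(\<theta> - e 0) / p\<rfloor>"
  have "of_int q \<le> (\<theta> - e 0) / p" "(\<theta> - e 0) / p < of_int q + 1"
    unfolding q_def by linarith+
  then have q: "e (N * q) \<le> \<theta>" "\<theta> < e (N * (q + 1))"
    using assms(2) period_multiple[of e N p 0 q] period_multiple[of e N p 0 "q + 1"] assms(4)
    by (auto simp: field_simps)
  define A where "A = {j \<in> {N * q..N * (q + 1)}. e j \<le> \<theta>}"
  have "finite A" unfolding A_def by (rule finite_subset[OF _ finite_atLeastAtMost_int[of "N * q" "N * (q + 1)"]]) auto
  moreover have "N * q \<in> A" using q assms(3) by (auto simp: A_def algebra_simps)
  ultimately have m: "Max A \<in> A" "\<And>j. j \<in> A \<Longrightarrow> j \<le> Max A" using Max_in[of A] Max_ge[of A] by blast+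
  have "Max A \<noteq> N * (q + 1)" using m(1) q by (auto simp: A_def)
  then have "Max A + 1 \<in> {N * q..N * (q + 1)}" using m(1) by (auto simp: A_def)
  moreover have "Max A + 1 \<notin> A" using m(2)[of "Max A + 1"] by auto
  ultimately have "\<theta> < e (Max A + 1)" unfolding A_def by auto
  then show thesis using m(1) that by (auto simp: A_def)
qed

lemma enumerate_finite_set:
  fixes S :: "real set"
  assumes "finite S"
  shows "\<exists>f :: nat \<Rightarrow> real. (\<forall>i j. i < j \<and> j < card S \<longrightarrow> f i < f j) \<and> f ` {..<card S} = S"
proof (intro exI[of _ "\<lambda>i. sorted_list_of_set S ! i"] conjI allI impI)
  let ?l = "sorted_list_of_set S"
  have len: "length ?l = card S" by simp
  show "?l ! i < ?l ! j" if "i < j \<and> j < card S" for i j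
    using that by (intro sorted_wrt_nth_less[OF strict_sorted_list_of_set]) (auto simp: len)
  have "(\<lambda>i. ?l ! i) ` {..<length ?l} = set ?l"
    by (auto simp: set_conv_nth)
  then show "(\<lambda>i. ?l ! i) ` {..<card S} = S" using assms by simp
qed

section \<open>Covers by arcs with interleaved normal cones\<close>

context constant_width_body
begin

text \<open>Write \<open>t\<^sub>j\<close> for \<open>f (2 j)\<close>. The boundary points \<open>x(t\<^sub>j + j pi)\<close> are the common ends of the arcs, and the
  values \<open>f (2 j + 1)\<close> separate their normal cones, taken modulo half turns. Extend \<open>t\<close> so
  that \<open>t\<^sub>j\<^sub>+\<^sub>n = t\<^sub>j + pi\<close>. As \<open>n\<close> is odd, the points with even index are all of them, their order around
  the boundary is \<open>t\<^sub>0, t\<^sub>2, t\<^sub>4, \<dots>\<close>, and \<open>n\<close> of them make a full turn. The arc from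
  \<open>t\<^sub>2\<^sub>i\<close> to \<open>t\<^sub>2\<^sub>i\<^sub>+\<^sub>2\<^sub>k\<close> is one step short of the half turn from \<open>t\<^sub>2\<^sub>i\<close> to \<open>t\<^sub>2\<^sub>i\<^sub>+\<^sub>n\<close>, and the
  separating values keep its normal cones within a half turn as well. Each direction lies between
  two neighbouring ends, and thus in \<open>k\<close> consecutive arcs.\<close>

lemma cover_of_interleaved_arcs:
  fixes f :: "nat \<Rightarrow> real" and k :: nat
  defines "n \<equiv> 2 * k + 1"
  assumes mono: "\<And>i j. i < j \<Longrightarrow> j < 2 * n \<Longrightarrow> f i < f j" and last: "f (2 * n - 1) < f 0 + pi"
    and right: "\<And>j. j < n \<Longrightarrow> supp_pt (f (2 * j) + j * pi) \<noteq> supp_pt (f (2 * j + 1) + j * pi)"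
    and left: "\<And>j. 0 < j \<Longrightarrow> j < n \<Longrightarrow> supp_pt (f (2 * j - 1) + j * pi) \<noteq> supp_pt (f (2 * j) + j * pi)"
    and wrap: "supp_pt (f (2 * n - 1) - pi) \<noteq> supp_pt (f 0)"
  shows "borsuk_coverable k C n"
proof -
  have npos: "0 < n" "0 < 2 * n" by (simp_all add: n_def)
  obtain e :: "int \<Rightarrow> real" where e: "strict_mono e"
    and per: "\<And>j. e (j + int (2 * n)) = e j + pi"
    and val: "\<And>q r. r < 2 * n \<Longrightarrow> e (q * int (2 * n) + int r) = f r + pi * of_int q"
    using periodic_extension[OF npos(2) mono last] by blast
  have turn: "supp_pt (\<theta> + pi * of_int (q * int n + int r + q)) = supp_pt (\<theta> + r * pi)" for \<theta> q r
  proof -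
    have "\<theta> + pi * of_int (q * int n + int r + q) = \<theta> + r * pi + 2 * pi * of_int (q * (int k + 1))"
      by (simp add: n_def algebra_simps)
    then show ?thesis by (simp only: supp_pt_turns)
  qed
  \<comment> \<open>Adding \<open>n\<close> to \<open>j\<close> shifts the angles by \<open>pi\<close> and, as \<open>n\<close> is odd, the sign \<open>j pi\<close> by \<open>pi\<close>
    up to full turns, so the inequalities extend to all integers.\<close>
  have neq: "supp_pt (e (2 * j) + pi * of_int j) \<noteq> supp_pt (e (2 * j + 1) + pi * of_int j) \<and>
      supp_pt (e (2 * j - 1) + pi * of_int j) \<noteq> supp_pt (e (2 * j) + pi * of_int j)" for j
  proof -
    define q r where "q = j div int n" and "r = nat (j mod int n)"
    have r: "r < n" and j: "j = q * int n + int r"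
      using npos by (auto simp: q_def r_def nat_less_iff)
    have "e (2 * j) = e (q * int (2 * n) + int (2 * r))"
      by (rule arg_cong[where f = e]) (simp add: j algebra_simps)
    then have e0: "e (2 * j) + pi * of_int j = f (2 * r) + pi * of_int (q * int n + int r + q)"
      using val[of "2 * r" q] r by (simp add: j algebra_simps)
    have "e (2 * j + 1) = e (q * int (2 * n) + int (2 * r + 1))"
      by (rule arg_cong[where f = e]) (simp add: j algebra_simps)
    then have e1: "e (2 * j + 1) + pi * of_int j = f (2 * r + 1) + pi * of_int (q * int n + int r + q)"
      using val[of "2 * r + 1" q] r by (simp add: j algebra_simps)
    have "supp_pt (e (2 * j - 1) + pi * of_int j) \<noteq> supp_pt (e (2 * j) + pi * of_int j)"
    proof (cases "r = 0")
      case False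
      then have "e (2 * j - 1) = e (q * int (2 * n) + int (2 * r - 1))"
        by (intro arg_cong[where f = e]) (simp add: j algebra_simps)
      then have "e (2 * j - 1) + pi * of_int j = f (2 * r - 1) + pi * of_int (q * int n + int r + q)"
        using val[of "2 * r - 1" q] r by (simp add: j algebra_simps)
      then show ?thesis unfolding e0 using left[of r] r False by (simp only: turn) simp
    next
      case True
      then have "e (2 * j - 1) = e ((q - 1) * int (2 * n) + int (2 * n - 1))"
        using npos by (intro arg_cong[where f = e]) (simp add: j algebra_simps)
      then have "e (2 * j - 1) + pi * of_int j = f (2 * n - 1) - pi + pi * of_int (q * int n + int r + q)"
        using val[of "2 * n - 1" "q - 1"] npos by (simp add: j algebra_simps)
      then show ?thesis unfolding e0 using wrap True by (simp only: turn) simp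
    qed
    moreover have "supp_pt (e (2 * j) + pi * of_int j) \<noteq> supp_pt (e (2 * j + 1) + pi * of_int j)"
      unfolding e0 e1 using right[OF r] by (simp only: turn) simp
    ultimately show ?thesis by blast
  qed
  have neq_even: "supp_pt (e (4 * i)) \<noteq> supp_pt (e (4 * i + 1))"
    "supp_pt (e (4 * i - 1)) \<noteq> supp_pt (e (4 * i))" for i
  proof -
    have "supp_pt (\<theta> + pi * of_int (2 * i)) = supp_pt \<theta>" for \<theta>
      using supp_pt_turns[of \<theta> i] by (simp add: algebra_simps)
    then show "supp_pt (e (4 * i)) \<noteq> supp_pt (e (4 * i + 1))"
      "supp_pt (e (4 * i - 1)) \<noteq> supp_pt (e (4 * i))"
      using neq[of "2 * i"] by simp_all
  qed
  define G where "G i = supp_pt ` {e (4 * i)..e (4 * (i + int k))}" for i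
  have per_turn: "e (j + 4 * int n) = e j + 2 * pi" for j
    using per[of j] per[of "j + int (2 * n)"] by (simp add: algebra_simps)
  have G_per: "G (i mod int n) = G i" for i
  proof -
    define q where "q = i div int n"
    have i: "i = i mod int n + int n * q" by (simp add: q_def)
    have sh: "e (4 * (i + c)) = e (4 * (i mod int n + c)) + 2 * pi * of_int q" for c
    proof -
      have "4 * (i + c) = 4 * (i mod int n + c) + (4 * int n) * q" by (subst i) (simp add: algebra_simps)
      then show ?thesis using period_multiple[of e "4 * int n" "2 * pi", OF per_turn] by metis
    qed
    have "G i = supp_pt ` ((\<lambda>\<theta>. \<theta> + 2 * pi * of_int q) ` {e (4 * (i mod int n))..e (4 * (i mod int n + int k))})"
      unfolding G_def using sh[of 0] sh[of "int k"] by simp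
    also have "\<dots> = G (i mod int n)"
      unfolding image_image supp_pt_turns G_def ..
    finally show ?thesis ..
  qed
  have small: "dist p q < w" if pq: "p \<in> G i" "q \<in> G i" for i p q
  proof -
    have "4 * (i + int k) + 1 = (4 * i - 1) + int (2 * n)" by (simp add: n_def)
    then have r: "e (4 * (i + int k) + 1) = e (4 * i - 1) + pi" using per by metis
    have "dist (supp_pt \<alpha>) (supp_pt \<beta>) < w"
      if "\<alpha> \<in> {e (4 * i)..e (4 * (i + int k))}" "\<beta> \<in> {e (4 * i)..e (4 * (i + int k))}" for \<alpha> \<beta>
    proof (rule arc_without_diametral_pair[OF _ _ neq_even(2) _ that])
      show "e (4 * i - 1) < e (4 * i)" using e by (simp add: strict_mono_less)
      show "e (4 * (i + int k)) < e (4 * i - 1) + pi"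
        unfolding r[symmetric] using e by (simp add: strict_mono_less)
      show "supp_pt (e (4 * (i + int k))) \<noteq> supp_pt (e (4 * i - 1) + pi)"
        unfolding r[symmetric] using neq_even(1)[of "i + int k"] .
    qed
    then show ?thesis using pq unfolding G_def by blast
  qed
  show ?thesis
  proof (rule cone_extension[where G = "\<lambda>i. G (int i)"])
    fix i assume "i < n"
    have "e (4 * int i) \<le> e (4 * (int i + int k))" using e by (simp add: strict_mono_less_eq)
    then show "compact (G (int i)) \<and> G (int i) \<noteq> {} \<and> G (int i) \<subseteq> frontier C"
      unfolding G_def using supp_pt_in_frontier
      by (auto intro!: compact_continuous_image continuous_on_supp_pt)
    show "\<And>p q. p \<in> G (int i) \<Longrightarrow> q \<in> G (int i) \<Longrightarrow> dist p q < w" using small by blast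
  next
    fix \<theta>
    have "strict_mono (\<lambda>j. e (4 * j))" using e by (simp add: strict_mono_def)
    moreover have "e (4 * (j + int n)) = e (4 * j) + 2 * pi" for j
      using per_turn[of "4 * j"] by (simp add: algebra_simps)
    ultimately obtain j where j: "e (4 * j) \<le> \<theta>" "\<theta> < e (4 * (j + 1))"
      using locate_in_sequence[of "\<lambda>j. e (4 * j)" "2 * pi" "int n" \<theta>] npos by auto
    have mem: "supp_pt \<theta> \<in> G i" if "i \<in> {j - int k<..j}" for i
    proof -
      have "e (4 * i) \<le> e (4 * j)" "e (4 * (j + 1)) \<le> e (4 * (i + int k))"
        using that e by (auto simp: strict_mono_less_eq)
      then have "\<theta> \<in> {e (4 * i)..e (4 * (i + int k))}" using j by auto
      then show ?thesis unfolding G_def by blast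
    qed
    have inj: "inj_on (\<lambda>i. nat (i mod int n)) {j - int k<..j}"
    proof (rule inj_onI)
      fix i i' assume i: "i \<in> {j - int k<..j}" "i' \<in> {j - int k<..j}" "nat (i mod int n) = nat (i' mod int n)"
      then have "i mod int n = i' mod int n" using npos by (simp add: nat_eq_iff)
      then have "int n dvd i - i'" by (simp add: mod_eq_dvd_iff)
      moreover have "\<bar>i - i'\<bar> < int n" using i by (auto simp: n_def)
      ultimately show "i = i'" using dvd_imp_le_int[of "i - i'" "int n"] by auto
    qed
    have "(\<lambda>i. nat (i mod int n)) ` {j - int k<..j} \<subseteq> {i. i < n \<and> supp_pt \<theta> \<in> G (int i)}"
      using mem npos G_per by (auto simp: nat_less_iff)
    then have "card ((\<lambda>i. nat (i mod int n)) ` {j - int k<..j}) \<le> card {i. i < n \<and> supp_pt \<theta> \<in> G (int i)}"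
      by (intro card_mono) auto
    then show "k \<le> card {i. i < n \<and> supp_pt \<theta> \<in> G (int i)}"
      by (simp add: card_image[OF inj])
  qed
qed

text \<open>The directions at which the boundary curve changes its type: no interval around \<open>z\<close> or around
  \<open>z + pi\<close> belongs to the normal cone of a single point. The two normals \<open>a\<close> and \<open>b\<close> of a vertex differ
  by less than a half turn.\<close>

definition switching :: "real \<Rightarrow> bool" where
  "switching z \<longleftrightarrow> (\<forall>a b. a < z \<and> z < b \<and> b < a + pi \<longrightarrow>
     supp_pt a \<noteq> supp_pt b \<and> supp_pt (a + pi) \<noteq> supp_pt (b + pi))"

lemma switchingD:
  assumes "switching z" "a < z" "z < b" "b < a + pi"
  shows "supp_pt a \<noteq> supp_pt b" "supp_pt (a + pi) \<noteq> supp_pt (b + pi)"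
  using assms unfolding switching_def by blast+

lemma switching_add_pi: "switching (z + pi) \<longleftrightarrow> switching z"
proof
  assume sw: "switching (z + pi)"
  show "switching z"
    unfolding switching_def
  proof (intro allI impI)
    fix a b assume "a < z \<and> z < b \<and> b < a + pi"
    then have "a + pi < z + pi" "z + pi < b + pi" "b + pi < a + pi + pi" by auto
    from switchingD[OF sw this]
    show "supp_pt a \<noteq> supp_pt b \<and> supp_pt (a + pi) \<noteq> supp_pt (b + pi)"
      using supp_pt_turn(1)[of a] supp_pt_turn(1)[of b] by (simp add: algebra_simps)
  qed
next
  assume sw: "switching z"
  show "switching (z + pi)"
    unfolding switching_def
  proof (intro allI impI)
    fix a b assume "a < z + pi \<and> z + pi < b \<and> b < a + pi"
    then have "a - pi < z" "z < b - pi" "b - pi < a - pi + pi" by auto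
    from switchingD[OF sw this]
    show "supp_pt a \<noteq> supp_pt b \<and> supp_pt (a + pi) \<noteq> supp_pt (b + pi)"
      by (simp add: supp_pt_turn)
  qed
qed

text \<open>Members of a list of switching directions that are two places apart have a switching direction
  between them, hence different support points, and so have their opposites. The members with numbers
  \<open>4 j\<close> and \<open>4 j + 2\<close> therefore serve as ends and separators.\<close>

lemma cover_if_infinitely_many_switches:
  assumes inf: "infinite {z \<in> {0..<pi}. switching z}"
  shows "borsuk_coverable k C (2 * k + 1)"
proof -
  define n where "n = 2 * k + 1"
  obtain S where S: "S \<subseteq> {z \<in> {0..<pi}. switching z}" "finite S" "card S = 4 * n"
    using infinite_arbitrarily_large[OF inf] by metis
  obtain g where g: "\<And>i j. i < j \<Longrightarrow> j < 4 * n \<Longrightarrow> g i < g j" "g ` {..<4 * n} = S"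
    using enumerate_finite_set[OF S(2)] S(3) by metis
  have gr: "0 \<le> g i" "g i < pi" "switching (g i)" if "i < 4 * n" for i
    using S(1) g(2) that by auto
  have sep: "supp_pt (g i + real j * pi) \<noteq> supp_pt (g (Suc (Suc i)) + real j * pi)" if i: "Suc (Suc i) < 4 * n" for i j
  proof -
    have *: "g i < g (Suc i)" "g (Suc i) < g (Suc (Suc i))" "g (Suc (Suc i)) < g i + pi"
      using g(1) gr[of i] gr[of "Suc (Suc i)"] i by auto
    note ne = switchingD[OF gr(3)[of "Suc i"] *]
    show ?thesis
    proof (cases "even j")
      case True
      then obtain l where "j = 2 * l" by blast
      then have "\<theta> + real j * pi = \<theta> + 2 * pi * of_int (int l)" for \<theta> by simp
      then show ?thesis using ne(1) i by (simp only: supp_pt_turns) simp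
    next
      case False
      then obtain l where "j = 2 * l + 1" using oddE by blast
      then have "\<theta> + real j * pi = \<theta> + pi + 2 * pi * of_int (int l)" for \<theta> by (simp add: algebra_simps)
      then show ?thesis using ne(2) i by (simp only: supp_pt_turns) simp
    qed
  qed
  have "borsuk_coverable k C (2 * k + 1)"
  proof (rule cover_of_interleaved_arcs[where f = "\<lambda>m. g (2 * m)"], fold n_def)
    have n: "n \<ge> 1" by (simp add: n_def)
    show "\<And>i j. i < j \<Longrightarrow> j < 2 * n \<Longrightarrow> g (2 * i) < g (2 * j)" using g(1) by simp
    have i: "2 * (2 * n - 1) < 4 * n" "0 < 4 * n" using n by auto
    show "g (2 * (2 * n - 1)) < g (2 * 0) + pi" using gr(1)[OF i(2)] gr(2)[OF i(1)] by simp
    show "supp_pt (g (2 * (2 * j)) + j * pi) \<noteq> supp_pt (g (2 * (2 * j + 1)) + j * pi)" if "j < n" for j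
      using sep[of "4 * j" j] that by simp
    show "supp_pt (g (2 * (2 * j - 1)) + j * pi) \<noteq> supp_pt (g (2 * (2 * j)) + j * pi)" if "0 < j" "j < n" for j
    proof -
      have "Suc (Suc (2 * (2 * j - 1))) = 2 * (2 * j)" using that by simp
      then show ?thesis using sep[of "2 * (2 * j - 1)" j] that by simp
    qed
    have sw: "switching (g (4 * n - 1) - pi)"
      using gr(3)[of "4 * n - 1"] switching_add_pi[of "g (4 * n - 1) - pi"] n by simp
    have "4 * n - 1 < 4 * n" "2 * (2 * n - 1) < 4 * n - 1" using n by auto
    then have "g (2 * (2 * n - 1)) < g (4 * n - 1)" "g (4 * n - 1) < pi" "0 \<le> g 0" "g 0 < g (2 * (2 * n - 1))"
      using g(1)[of "2 * (2 * n - 1)" "4 * n - 1"] gr(2)[of "4 * n - 1"] gr(1)[of 0] g(1)[of 0 "2 * (2 * n - 1)"] n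
      by auto
    then show "supp_pt (g (2 * (2 * n - 1)) - pi) \<noteq> supp_pt (g (2 * 0))"
      using switchingD(1)[OF sw, of "g (2 * (2 * n - 1)) - pi" "g 0"] by simp
  qed
  then show ?thesis .
qed

end

section \<open>Circle arcs in the boundary\<close>

text \<open>If both of the arcs into which two points of a connected set divide the circle contained a
  missing point, the line through the two missing points would separate the set.\<close>

lemma connected_circle_contains_arc:
  assumes A: "connected A" "A \<subseteq> sphere c r" "p \<in> A" "q \<in> A" "p \<noteq> q" and r: "0 < r"
  shows "\<exists>a b. a < b \<and> (\<forall>\<theta>. a \<le> \<theta> \<and> \<theta> \<le> b \<longrightarrow> c + r *\<^sub>R dir \<theta> \<in> A)"
proof (rule ccontr)
  assume none: "\<not> ?thesis"
  have polar: "\<exists>\<theta>. y = c + r *\<^sub>R dir \<theta>" if "y \<in> A" for y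
  proof -
    have "norm (y - c) = r" using A(2) that by (auto simp: dist_norm norm_minus_commute)
    then have "norm ((y - c) /\<^sub>R r) = 1" using r by simp
    then obtain \<theta> where "(y - c) /\<^sub>R r = dir \<theta>" by (rule unit_vector_dir)
    then have "r *\<^sub>R dir \<theta> = y - c" using r by (metis divideR_right less_irrefl)
    then have "y = c + r *\<^sub>R dir \<theta>" by simp
    then show ?thesis by blast
  qed
  obtain \<alpha> \<beta>0 where p: "p = c + r *\<^sub>R dir \<alpha>" and q0: "q = c + r *\<^sub>R dir \<beta>0"
    using polar A(3,4) by blast
  define k where "k = \<lfloor>(\<beta>0 - \<alpha>) / (2 * pi)\<rfloor>"
  define \<beta> where "\<beta> = \<beta>0 - 2 * pi * of_int k"
  have q: "q = c + r *\<^sub>R dir \<beta>"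
    using dir_plus_turns[of \<beta> k] q0 by (simp add: \<beta>_def)
  have "of_int k \<le> (\<beta>0 - \<alpha>) / (2 * pi)" "(\<beta>0 - \<alpha>) / (2 * pi) < of_int k + 1"
    unfolding k_def by linarith+
  then have "\<alpha> \<le> \<beta>" "\<beta> < \<alpha> + 2 * pi" by (auto simp: \<beta>_def field_simps)
  moreover have "\<alpha> \<noteq> \<beta>" using p q A(5) by auto
  ultimately have ab: "\<alpha> < \<beta>" "\<beta> < \<alpha> + 2 * pi" by auto
  have missing: "\<exists>\<theta>. a \<le> \<theta> \<and> \<theta> \<le> b \<and> c + r *\<^sub>R dir \<theta> \<notin> A" if "a < b" for a b
    using none that by blast
  obtain \<gamma> where g: "\<alpha> \<le> \<gamma>" "\<gamma> \<le> \<beta>" "c + r *\<^sub>R dir \<gamma> \<notin> A"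
    using missing[OF ab(1)] by blast
  obtain \<delta> where d: "\<beta> \<le> \<delta>" "\<delta> \<le> \<alpha> + 2 * pi" "c + r *\<^sub>R dir \<delta> \<notin> A"
    using missing[OF ab(2)] by blast
  have "dir (\<alpha> + 2 * pi) = dir \<alpha>" using dir_plus_turns[of \<alpha> 1] by simp
  then have strict: "\<alpha> < \<gamma>" "\<gamma> < \<beta>" "\<beta> < \<delta>" "\<delta> < \<alpha> + 2 * pi"
    using g d p q A(3,4) by (metis less_eq_real_def)+
  define \<mu> \<rho> where "\<mu> = (\<gamma> + \<delta>) / 2" and "\<rho> = (\<delta> - \<gamma>) / 2"
  have \<rho>: "0 < \<rho>" "\<rho> < pi" "\<gamma> = \<mu> - \<rho>" "\<delta> = \<mu> + \<rho>" using strict by (auto simp: \<mu>_def \<rho>_def field_simps)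
  have "cos \<rho> < cos (\<mu> - \<beta>)"
  proof -
    have "\<bar>\<mu> - \<beta>\<bar> < \<rho>" using strict \<rho> by linarith
    then have "cos \<rho> < cos \<bar>\<mu> - \<beta>\<bar>" using \<rho> by (intro cos_monotone_0_pi) auto
    then show ?thesis by (simp only: cos_abs_real)
  qed
  moreover have "cos (\<mu> - \<alpha>) < cos \<rho>"
  proof (cases "\<mu> - \<alpha> \<le> pi")
    case True
    then show ?thesis using strict \<rho> by (intro cos_monotone_0_pi) auto
  next
    case False
    then have "cos (2 * pi - (\<mu> - \<alpha>)) < cos \<rho>" using strict \<rho> by (intro cos_monotone_0_pi) auto
    then show ?thesis by (simp only: cos_2pi_minus)
  qed
  ultimately have "dir \<mu> \<bullet> p \<le> dir \<mu> \<bullet> c + r * cos \<rho>" "dir \<mu> \<bullet> c + r * cos \<rho> \<le> dir \<mu> \<bullet> q"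
    using r by (auto simp: p q inner_add_right inner_dir)
  then obtain y where y: "y \<in> A" "dir \<mu> \<bullet> y = dir \<mu> \<bullet> c + r * cos \<rho>"
    using connected_ivt_hyperplane[OF A(1,3,4)] by blast
  obtain \<theta> where t: "y = c + r *\<^sub>R dir \<theta>" using polar[OF y(1)] by blast
  then have "cos (\<mu> - \<theta>) = cos \<rho>" using y(2) r by (simp add: inner_add_right inner_dir)
  then obtain n where "n \<in> \<int>" "\<mu> - \<theta> = \<rho> + 2 * n * pi \<or> \<mu> - \<theta> = - \<rho> + 2 * n * pi"
    using cos_eq by blast
  then obtain k :: int where "\<gamma> = \<theta> + 2 * pi * of_int k \<or> \<delta> = \<theta> + 2 * pi * of_int k"
    using \<rho>(3,4) by (elim Ints_cases) (auto simp: algebra_simps)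
  then have "y = c + r *\<^sub>R dir \<gamma> \<or> y = c + r *\<^sub>R dir \<delta>"
    unfolding t by (auto simp: dir_plus_turns)
  then show False using y(1) g(3) d(3) by blast
qed

lemma circle_arc_dir:
  assumes "a < b" "b < a + 2 * pi" "0 < r"
  shows "circle_arc r ((\<lambda>\<theta>. c + r *\<^sub>R dir \<theta>) ` {a..b})"
proof -
  define g where "g = (\<lambda>\<theta>. c + r *\<^sub>R dir \<theta>) \<circ> (\<lambda>t. a + t * (b - a))"
  have "(\<lambda>t. a + t * (b - a)) ` {0..1} = {a..b}"
  proof (intro subset_antisym subsetI)
    fix x assume "x \<in> {a..b}"
    then show "x \<in> (\<lambda>t. a + t * (b - a)) ` {0..1}"
      using assms(1) by (intro image_eqI[of _ _ "(x - a) / (b - a)"]) (auto simp: divide_simps)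
  next
    fix x assume "x \<in> (\<lambda>t. a + t * (b - a)) ` {0..1}"
    then obtain t where t: "x = a + t * (b - a)" "0 \<le> t" "t \<le> 1" unfolding image_iff by force
    have "t * (b - a) \<le> 1 * (b - a)" "0 \<le> t * (b - a)" using t assms(1) by (auto intro: mult_right_mono)
    then show "x \<in> {a..b}" using t(1) by auto
  qed
  then have im: "path_image g = (\<lambda>\<theta>. c + r *\<^sub>R dir \<theta>) ` {a..b}"
    unfolding path_image_def g_def image_comp[symmetric] by simp
  have "path g"
    unfolding path_def g_def o_def
    by (intro continuous_intros continuous_on_compose2[OF continuous_on_dir[of UNIV]]) auto
  moreover have "inj_on g {0..1}"
  proof (rule linorder_inj_onI)
    fix s t :: real assume st: "s < t" "s \<in> {0..1}" "t \<in> {0..1}"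
    have "(t - s) * (b - a) \<le> 1 * (b - a)" "0 < (t - s) * (b - a)"
      using st assms(1) by (auto intro!: mult_right_mono)
    then have "dir (a + s * (b - a)) \<noteq> dir (a + t * (b - a))"
      using assms(2) by (intro dir_neq) (auto simp: algebra_simps)
    then show "g s \<noteq> g t" using assms(3) by (simp add: g_def)
  qed auto
  ultimately have "arc g" by (simp add: arc_def)
  then show ?thesis
    unfolding circle_arc_def im[symmetric]
    using assms(3) by (intro exI[of _ c] exI[of _ g]) (auto simp: im dist_norm)
qed

context constant_width_body
begin

text \<open>At an interior point of the arc the direction of the radius is the only possible outer normal,
  since the inner product with a normal is maximal there along the arc; the centre is then the
  opposite support point.\<close>

lemma boundary_arc_center:
  assumes "circle_arc w B" "B \<subseteq> frontier C"
  obtains c p q where "c \<in> C" "B \<subseteq> sphere c w" "p \<in> B" "q \<in> B" "p \<noteq> q"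
proof -
  obtain c g where cg: "arc g" "path_image g = B" "B \<subseteq> sphere c w"
    using assms(1) unfolding circle_arc_def by blast
  have B: "connected B" "pathstart g \<in> B" "pathfinish g \<in> B" "pathstart g \<noteq> pathfinish g"
    using cg connected_path_image[OF arc_imp_path[OF cg(1)]] arc_distinct_ends[OF cg(1)] by auto
  obtain a b where ab: "a < b" "\<And>\<theta>. a \<le> \<theta> \<Longrightarrow> \<theta> \<le> b \<Longrightarrow> c + w *\<^sub>R dir \<theta> \<in> B"
    using connected_circle_contains_arc[OF B(1) cg(3) B(2-4) width_pos] by metis
  define m where "m = (a + b) / 2"
  have "c + w *\<^sub>R dir m \<in> range supp_pt"
    using ab assms(2) frontier_eq_range by (auto simp: m_def)
  then obtain \<phi> where \<phi>: "supp_pt \<phi> = c + w *\<^sub>R dir m" by auto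
  have max: "cos (\<theta> - \<phi>) \<le> cos (m - \<phi>)" if "a \<le> \<theta>" "\<theta> \<le> b" for \<theta>
  proof -
    have "c + w *\<^sub>R dir \<theta> \<in> C"
      using ab(2)[OF that] assms(2) frontier_subset_closed[OF closed_C] by blast
    from supp_pt(2)[OF this, of \<phi>] have "w * cos (\<phi> - \<theta>) \<le> w * cos (\<phi> - m)"
      unfolding \<phi> by (simp add: inner_add_right inner_dir)
    then have "cos (\<phi> - \<theta>) \<le> cos (\<phi> - m)" using width_pos by simp
    then show ?thesis by (metis cos_minus minus_diff_eq)
  qed
  have "((\<lambda>\<theta>. cos (\<theta> - \<phi>)) has_real_derivative - sin (m - \<phi>)) (at m)"
    by (auto intro!: derivative_eq_intros)
  moreover have "\<forall>y. \<bar>m - y\<bar> < (b - a) / 2 \<longrightarrow> cos (y - \<phi>) \<le> cos (m - \<phi>)"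
  proof (intro allI impI)
    fix y assume "\<bar>m - y\<bar> < (b - a) / 2"
    then have "a \<le> y" "y \<le> b" unfolding m_def by (auto simp: abs_if field_simps split: if_splits)
    then show "cos (y - \<phi>) \<le> cos (m - \<phi>)" by (rule max)
  qed
  ultimately have "- sin (m - \<phi>) = 0"
    using DERIV_local_max[of "\<lambda>\<theta>. cos (\<theta> - \<phi>)" "- sin (m - \<phi>)" m "(b - a) / 2"] ab(1) by auto
  then have s0: "sin (m - \<phi>) = 0" by simp
  have "cos (m - \<phi>) = 1"
  proof (rule ccontr)
    assume "cos (m - \<phi>) \<noteq> 1"
    then have m1: "cos (m - \<phi>) = -1"
      using s0 sin_cos_squared_add[of "m - \<phi>"] by (simp add: power2_eq_1_iff)
    define h where "h = min ((b - a) / 2) 1"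
    have h: "0 < h" "h < pi" using ab(1) pi_gt3 by (auto simp: h_def min_less_iff_disj)
    have "a \<le> m + h" "m + h \<le> b" using h(1) ab(1) by (auto simp: m_def h_def min_def field_simps)
    then have "cos (m + h - \<phi>) \<le> -1" using max m1 by metis
    moreover have "cos (m + h - \<phi>) = - cos h"
    proof -
      have "m + h - \<phi> = (m - \<phi>) + h" by simp
      then show ?thesis using m1 s0 cos_add[of "m - \<phi>" h] by (metis diff_0 mult_minus1 mult_zero_left minus_diff_eq diff_zero)
    qed
    moreover have "cos h < cos 0" using h by (intro cos_monotone_0_pi) auto
    ultimately show False by simp
  qed
  then have "dir m \<bullet> dir \<phi> = 1" by (simp add: inner_dir)
  then have "dir \<phi> = 1 *\<^sub>R dir m" by (intro unit_vector_from_inner) auto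
  then have "c = supp_pt (\<phi> + pi)" using \<phi> opposite[of \<phi>] by simp
  then show thesis using that[of c] cg(3) B supp_pt(1) by blast
qed

text \<open>The centres \<open>K\<close> of the finitely many arcs contain, for each direction, one of the two opposite
  support points. A switching direction or its opposite is therefore an end of the normal cone of a
  point of \<open>K\<close>, and a normal cone has two ends.\<close>

lemma finitely_many_switches:
  assumes "reuleaux_polygon_of_width w C"
  shows "finite {z \<in> {0..<pi}. switching z}"
proof -
  obtain \<A> where fin: "finite \<A>" and arcs: "\<And>A. A \<in> \<A> \<Longrightarrow> circle_arc w A" and fr: "frontier C = \<Union>\<A>"
    using assms unfolding reuleaux_polygon_of_width_def by blast
  have "\<exists>c. c \<in> C \<and> A \<subseteq> sphere c w" if "A \<in> \<A>" for A
    using boundary_arc_center[OF arcs[OF that]] fr that by (metis Union_upper)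
  then obtain cen where cen: "\<And>A. A \<in> \<A> \<Longrightarrow> cen A \<in> C \<and> A \<subseteq> sphere (cen A) w" by metis
  define K where "K = cen ` \<A>"
  have K: "finite K" using fin by (simp add: K_def)
  have opp: "\<exists>\<phi>. \<theta> - pi < \<phi> \<and> \<phi> < \<theta> + pi \<and> supp_pt \<phi> = supp_pt \<theta> \<and> supp_pt (\<phi> + pi) \<in> K" for \<theta>
  proof -
    obtain A where A: "A \<in> \<A>" "supp_pt \<theta> \<in> A" using supp_pt_in_frontier fr by blast
    then have "dist (supp_pt \<theta>) (cen A) = w" using cen[OF A(1)] by (auto simp: dist_commute)
    then obtain \<phi> where \<phi>: "supp_pt \<theta> = supp_pt \<phi>" "cen A = supp_pt (\<phi> + pi)"
      using diametral_pair[OF supp_pt(1)] cen[OF A(1)] by metis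
    obtain q :: int where q: "\<theta> - pi < \<phi> + 2 * pi * q" "\<phi> + 2 * pi * q < \<theta> + pi"
      using same_supp_pt_near[OF \<phi>(1)] .
    have "\<phi> + 2 * pi * q + pi = \<phi> + pi + 2 * pi * q" by simp
    then have "supp_pt (\<phi> + 2 * pi * q + pi) = cen A" using \<phi>(2) supp_pt_turns by metis
    then show ?thesis using q \<phi>(1) supp_pt_turns[of \<phi> q] A(1) by (auto simp: K_def)
  qed
  have mid: "supp_pt \<mu> \<in> K" if ab: "a < \<mu>" "\<mu> < b" "b < a + pi" "supp_pt a = supp_pt b" for a b \<mu>
  proof -
    obtain \<phi> where \<phi>: "\<mu> < \<phi>" "\<phi> < \<mu> + 2 * pi" "supp_pt \<phi> = supp_pt (\<mu> + pi)" "supp_pt (\<phi> + pi) \<in> K"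
      using opp[of "\<mu> + pi"] by auto
    have const: "supp_pt x = supp_pt a" if "a \<le> x" "x \<le> b" for x
      using normal_cone_convex[OF that ab(3,4)] .
    have "\<phi> = \<mu> + pi"
    proof (rule linorder_cases[of \<phi> "\<mu> + pi"])
      assume lt: "\<phi> < \<mu> + pi"
      define x where "x = max \<phi> (a + pi)"
      have x: "x < \<mu> + pi" "\<phi> \<le> x" "a + pi \<le> x" using lt ab by (auto simp: x_def)
      have "supp_pt x = supp_pt \<phi>" using x \<phi> by - (rule normal_cone_convex[of _ _ "\<mu> + pi"]; auto)
      moreover have "supp_pt (x - pi) = supp_pt \<mu>" using const[of "x - pi"] const[of \<mu>] x ab by auto
      ultimately show ?thesis using not_both_constant[of "x - pi" \<mu>] x \<phi> by auto
    next
      assume gt: "\<mu> + pi < \<phi>"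
      define x where "x = min \<phi> (b + pi)"
      have x: "\<mu> + pi < x" "x \<le> \<phi>" "x \<le> b + pi" using gt ab by (auto simp: x_def)
      have "supp_pt x = supp_pt (\<mu> + pi)" using x \<phi> by - (rule normal_cone_convex[of _ _ \<phi>]; auto)
      moreover have "supp_pt \<mu> = supp_pt (x - pi)" using const[of "x - pi"] const[of \<mu>] x ab by auto
      ultimately show ?thesis using not_both_constant[of \<mu> "x - pi"] x \<phi> by auto
    qed auto
    then show ?thesis using \<phi>(4) supp_pt_turn(1)[of \<mu>] by (simp add: algebra_simps)
  qed
  have key: "supp_pt \<theta> \<in> K \<or> supp_pt (\<theta> + pi) \<in> K" for \<theta>
  proof -
    obtain \<phi> where \<phi>: "\<theta> - pi < \<phi>" "\<phi> < \<theta> + pi" "supp_pt \<phi> = supp_pt \<theta>" "supp_pt (\<phi> + pi) \<in> K"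
      using opp[of \<theta>] by blast
    define a b where "a = min \<theta> \<phi>" and "b = max \<theta> \<phi>"
    have ab: "b < a + pi" "supp_pt a = supp_pt b" "supp_pt a = supp_pt \<theta>"
      using \<phi> by (auto simp: a_def b_def min_def max_def)
    show ?thesis
    proof (cases "\<theta> = \<phi>")
      case True then show ?thesis using \<phi>(4) by simp
    next
      case False
      then have "a < b" by (auto simp: a_def b_def)
      then have m: "a < (a + b) / 2" "(a + b) / 2 < b" by auto
      then have "supp_pt ((a + b) / 2) = supp_pt a" using ab by - (rule normal_cone_convex[of _ _ b]; auto)
      then show ?thesis using mid[OF m ab(1,2)] ab(3) by simp
    qed
  qed
  have few: "finite T" if T: "T \<subseteq> {z \<in> {0..<pi}. switching z}"
    "(\<forall>z\<in>T. supp_pt z = c) \<or> (\<forall>z\<in>T. supp_pt (z + pi) = c)" for T c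
  proof (rule ccontr)
    assume "infinite T"
    then obtain S where S: "S \<subseteq> T" "finite S" "card S = 3"
      using infinite_arbitrarily_large by metis
    obtain g where g: "\<And>i j. i < j \<Longrightarrow> j < 3 \<Longrightarrow> g i < (g j :: real)" "g ` {..<3::nat} = S"
      using enumerate_finite_set[OF S(2)] S(3) by metis
    have gT: "g 0 \<in> T" "g 1 \<in> T" "g 2 \<in> T" using S(1) g(2) by auto
    have "0 \<le> g 0" "g 2 < pi" using gT T(1) by auto
    then have *: "switching (g 1)" "g 0 < g 1" "g 1 < g 2" "g 2 < g 0 + pi"
      using g(1)[of 0 1] g(1)[of 1 2] gT T(1) by auto
    have "supp_pt (g 0) = supp_pt (g 2) \<or> supp_pt (g 0 + pi) = supp_pt (g 2 + pi)"
      using T(2) gT by metis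
    then show False using switchingD[OF *] by blast
  qed
  have "finite {z \<in> {z \<in> {0..<pi}. switching z}. supp_pt z = c}"
    "finite {z \<in> {z \<in> {0..<pi}. switching z}. supp_pt (z + pi) = c}" for c
    by (rule few[of _ c]; blast)+
  then have "finite (\<Union>c\<in>K. {z \<in> {z \<in> {0..<pi}. switching z}. supp_pt z = c} \<union>
      {z \<in> {z \<in> {0..<pi}. switching z}. supp_pt (z + pi) = c})"
    using K by blast
  moreover have "{z \<in> {0..<pi}. switching z} \<subseteq> (\<Union>c\<in>K. {z \<in> {z \<in> {0..<pi}. switching z}. supp_pt z = c} \<union>
      {z \<in> {z \<in> {0..<pi}. switching z}. supp_pt (z + pi) = c})"
    using key by blast
  ultimately show ?thesis by (rule finite_subset[rotated])
qed

end

section \<open>Reuleaux polygons in terms of support points\<close>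

text \<open>The switching directions \<open>e j\<close> of a Reuleaux polygon in increasing order, numbered so that the
  intervals \<open>[e j, e (j + 1)]\<close> with even \<open>j\<close> are the normal cones of the vertices. A half turn advances
  the index by an odd number and thus exchanges even and odd intervals, so those with odd \<open>j\<close> are
  opposite to vertices and belong to the sides.\<close>

locale reuleaux_angles = constant_width_body +
  fixes e :: "int \<Rightarrow> real" and s :: nat
  assumes mono: "strict_mono e"
    and period: "e (j + (2 * int s + 1)) = e j + pi"
    and vertex_ends: "even j \<Longrightarrow> supp_pt (e j) = supp_pt (e (j + 1))"
begin

abbreviation N :: int where "N \<equiv> 2 * int s + 1"

lemma e_less: "e i < e j \<longleftrightarrow> i < j" and e_le: "e i \<le> e j \<longleftrightarrow> i \<le> j"
  using mono by (simp_all add: strict_mono_less strict_mono_less_eq)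

lemma gap: "e (j + 1) < e j + pi"
proof -
  have ev: "e (j + 1) < e j + pi" if "even j" for j
  proof -
    have "e (j + 1) \<le> e j + pi" unfolding period[of j, symmetric] e_le by simp
    moreover have "e (j + 1) \<noteq> e j + pi"
      using vertex_ends[OF that] supp_pt_opposite_neq[of "e j"] by metis
    ultimately show ?thesis by simp
  qed
  show ?thesis
  proof (cases "even j")
    case False
    then have "e (j + N + 1) < e (j + N) + pi" by (intro ev) simp
    then show ?thesis using period[of j] period[of "j + 1"] by (simp add: algebra_simps)
  qed (rule ev)
qed

lemma vertex:
  assumes "even j" "e j \<le> \<theta>" "\<theta> \<le> e (j + 1)"
  shows "supp_pt \<theta> = supp_pt (e j)"
  using normal_cone_convex[OF assms(2,3) gap vertex_ends[OF assms(1)]] .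

lemma side:
  assumes "odd j" "e j \<le> \<theta>" "\<theta> \<le> e (j + 1)"
  shows "supp_pt (\<theta> + pi) = supp_pt (e j + pi)"
  using vertex[of "j + N" "\<theta> + pi"] assms period[of j] period[of "j + 1"]
  by (simp add: algebra_simps)

lemma side_injective:
  assumes "odd j" "e j \<le> a" "a < b" "b \<le> e (j + 1)"
  shows "supp_pt a \<noteq> supp_pt b"
proof
  assume "supp_pt a = supp_pt b"
  moreover have "b < a + 2 * pi" using assms gap[of j] pi_gt_zero by linarith
  ultimately have "supp_pt (a + pi) \<noteq> supp_pt (b + pi)" using not_both_constant assms(3) by blast
  moreover have "supp_pt (a + pi) = supp_pt (e j + pi)" "supp_pt (b + pi) = supp_pt (e j + pi)"
    using side[OF assms(1), of a] side[OF assms(1), of b] assms by simp_all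
  ultimately show False by simp
qed

text \<open>A second normal would make the support point constant on an interval at \<open>\<theta>\<close>, on which the opposite
  support point is constant already.\<close>

lemma side_point_normal:
  assumes "odd j" "e j < \<theta>" "\<theta> < e (j + 1)" "supp_pt \<phi> = supp_pt \<theta>"
  obtains q :: int where "\<phi> + 2 * pi * of_int q = \<theta>"
proof -
  obtain q :: int where q: "\<theta> - pi < \<phi> + 2 * pi * of_int q" "\<phi> + 2 * pi * of_int q < \<theta> + pi"
    using same_supp_pt_near[OF assms(4)[symmetric]] .
  define \<psi> where "\<psi> = \<phi> + 2 * pi * of_int q"
  have e: "supp_pt \<psi> = supp_pt \<theta>" by (simp add: \<psi>_def supp_pt_turns assms(4))
  have "\<psi> = \<theta>"
  proof (rule linorder_cases[of \<psi> \<theta>])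
    assume lt: "\<psi> < \<theta>"
    define x where "x = max \<psi> (e j)"
    have x: "\<psi> \<le> x" "x \<le> \<theta>" "x < \<theta>" "e j \<le> x" "\<theta> < \<psi> + pi" using lt assms q by (auto simp: x_def \<psi>_def)
    have "supp_pt x = supp_pt \<psi>" by (rule normal_cone_convex[OF x(1,2,5) e])
    then show ?thesis using side_injective[OF assms(1) x(4,3)] assms(3) e by simp
  next
    assume gt: "\<theta> < \<psi>"
    define x where "x = min \<psi> (e (j + 1))"
    have x: "\<theta> \<le> x" "x \<le> \<psi>" "\<theta> < x" "x \<le> e (j + 1)" "\<psi> < \<theta> + pi" using gt assms q by (auto simp: x_def \<psi>_def)
    have "supp_pt x = supp_pt \<theta>" by (rule normal_cone_convex[OF x(1,2,5) e[symmetric]])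
    then show ?thesis using side_injective[OF assms(1) _ x(3,4)] assms(2) by simp
  qed
  then show thesis using that \<psi>_def by blast
qed

text \<open>The normal cone cannot reach into the adjacent intervals, on which the boundary curve is
  injective.\<close>

lemma vertex_normal_cone:
  assumes "even j" "supp_pt \<phi> = supp_pt (e j)"
  obtains q :: int where "e j \<le> \<phi> + 2 * pi * of_int q" "\<phi> + 2 * pi * of_int q \<le> e (j + 1)"
proof -
  define \<mu> where "\<mu> = (e j + e (j + 1)) / 2"
  have \<mu>: "e j < \<mu>" "\<mu> < e (j + 1)" using e_less[of j "j + 1"] by (auto simp: \<mu>_def)
  then have \<mu>s: "supp_pt \<mu> = supp_pt \<phi>" using vertex[OF assms(1), of \<mu>] assms(2) by simp
  obtain q :: int where q: "\<mu> - pi < \<phi> + 2 * pi * of_int q" "\<phi> + 2 * pi * of_int q < \<mu> + pi"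
    using same_supp_pt_near[OF \<mu>s] .
  define \<psi> where "\<psi> = \<phi> + 2 * pi * of_int q"
  have e: "supp_pt \<psi> = supp_pt \<mu>" by (simp add: \<psi>_def supp_pt_turns \<mu>s)
  have "e j \<le> \<psi>"
  proof (rule ccontr)
    assume lt: "\<not> e j \<le> \<psi>"
    define x where "x = max \<psi> (e (j - 1))"
    have x: "\<psi> \<le> x" "x \<le> \<mu>" "x < e j" "e (j - 1) \<le> x" "\<mu> < \<psi> + pi"
      using lt q \<mu> e_less[of "j - 1" j] by (auto simp: x_def \<psi>_def)
    have "supp_pt x = supp_pt (e j)"
      using normal_cone_convex[OF x(1,2,5) e] normal_cone_convex[of \<psi> "e j" \<mu>, OF _ _ x(5) e] lt \<mu> by simp
    then show False using side_injective[of "j - 1" x "e j"] x assms(1) by simp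
  qed
  moreover have "\<psi> \<le> e (j + 1)"
  proof (rule ccontr)
    assume gt: "\<not> \<psi> \<le> e (j + 1)"
    define x where "x = min \<psi> (e (j + 2))"
    have x: "\<mu> \<le> x" "x \<le> \<psi>" "e (j + 1) < x" "x \<le> e (j + 2)" "\<psi> < \<mu> + pi"
      using gt q \<mu> e_less[of "j + 1" "j + 2"] by (auto simp: x_def \<psi>_def)
    have "supp_pt x = supp_pt (e (j + 1))"
      using normal_cone_convex[OF x(1,2,5) e[symmetric]]
        normal_cone_convex[of \<mu> "e (j + 1)" \<psi>, OF _ _ x(5) e[symmetric]] gt \<mu> by simp
    then show False using side_injective[of "j + 1" "e (j + 1)" x] x assms(1) by (simp add: add.assoc)
  qed
  ultimately show thesis using that \<psi>_def by blast
qed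

lemma locate:
  obtains j where "e j \<le> \<theta>" "\<theta> < e (j + 1)"
  using locate_in_sequence[OF mono pi_gt_zero _ period] by auto

text \<open>The index counts the odd intervals of directions only, so that \<open>2 s + 1\<close> consecutive indices run
  once around the boundary.\<close>

definition side_arc :: "int \<Rightarrow> (real^2) set" where
  "side_arc i = supp_pt ` {e (2 * i + 1)..e (2 * i + 2)}"

lemma side_arc_period: "side_arc (i mod N) = side_arc i"
proof -
  define q where "q = i div N"
  have i: "i = i mod N + N * q" by (simp add: q_def)
  have sh: "e (2 * i + c) = e (2 * (i mod N) + c) + 2 * pi * of_int q" for c
  proof -
    have "2 * i + c = 2 * (i mod N) + c + N * (2 * q)" by (subst i) (simp add: algebra_simps)
    then show ?thesis using period_multiple[of e N pi, OF period] by (metis mult.assoc mult.commute of_int_mult of_int_numeral)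
  qed
  have "side_arc i = supp_pt ` ((\<lambda>\<theta>. \<theta> + 2 * pi * of_int q) ` {e (2 * (i mod N) + 1)..e (2 * (i mod N) + 2)})"
    unfolding side_arc_def sh by simp
  also have "\<dots> = side_arc (i mod N)"
    unfolding image_image supp_pt_turns side_arc_def ..
  finally show ?thesis ..
qed

lemma circle_arc_side_arc: "circle_arc w (side_arc i)"
proof -
  let ?c = "supp_pt (e (2 * i + 1) + pi)"
  have "supp_pt \<theta> = ?c + w *\<^sub>R dir \<theta>" if "\<theta> \<in> {e (2 * i + 1)..e (2 * i + 2)}" for \<theta>
    using opposite[of \<theta>] side[of "2 * i + 1" \<theta>] that by (simp add: add.assoc)
  then have "side_arc i = (\<lambda>\<theta>. ?c + w *\<^sub>R dir \<theta>) ` {e (2 * i + 1)..e (2 * i + 2)}"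
    unfolding side_arc_def by (rule image_cong[OF refl])
  moreover have "e (2 * i + 1) < e (2 * i + 2)" by (simp add: e_less)
  moreover have "e (2 * i + 2) < e (2 * i + 1) + 2 * pi"
  proof -
    have "e (2 * i + 2) < e (2 * i + 1) + pi" using gap[of "2 * i + 1"] by (simp add: add.assoc)
    then show ?thesis using pi_gt_zero by linarith
  qed
  ultimately show ?thesis using circle_arc_dir[OF _ _ width_pos] by metis
qed

lemma side_arc_frontier: "side_arc i \<subseteq> frontier C"
  unfolding side_arc_def using supp_pt_in_frontier by blast

lemma frontier_eq_sides: "frontier C = \<Union> (side_arc ` {0..<N})"
proof
  show "\<Union> (side_arc ` {0..<N}) \<subseteq> frontier C" using side_arc_frontier by blast
  show "frontier C \<subseteq> \<Union> (side_arc ` {0..<N})"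
  proof
    fix p assume "p \<in> frontier C"
    then obtain \<theta> where p: "p = supp_pt \<theta>" using frontier_eq_range by auto
    obtain j where j: "e j \<le> \<theta>" "\<theta> < e (j + 1)" by (rule locate)
    have "\<exists>i. p \<in> side_arc i"
    proof (cases "even j")
      case True
      then obtain l where l: "j = 2 * l" by blast
      have "p = supp_pt (e (2 * (l - 1) + 2))" using vertex[OF True j(1)] j(2) by (simp add: p l)
      moreover have "e (2 * (l - 1) + 1) \<le> e (2 * (l - 1) + 2)" by (simp add: e_le)
      ultimately have "p \<in> side_arc (l - 1)" unfolding side_arc_def by simp
      then show ?thesis ..
    next
      case False
      then obtain l where "j = 2 * l + 1" using oddE by blast
      then have "p \<in> side_arc l" unfolding side_arc_def using j p by (simp add: add.assoc)
      then show ?thesis ..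
    qed
    then obtain i where "p \<in> side_arc i" ..
    then have "p \<in> side_arc (i mod N)" by (simp add: side_arc_period)
    moreover have "i mod N \<in> {0..<N}" using pos_mod_bound[of N i] pos_mod_sign[of N i] by simp
    ultimately show "p \<in> \<Union> (side_arc ` {0..<N})" by blast
  qed
qed

lemma is_reuleaux_polygon: "reuleaux_polygon_of_width w C"
  unfolding reuleaux_polygon_of_width_def
  using body width frontier_eq_sides circle_arc_side_arc
  by (intro conjI exI[of _ "side_arc ` {0..<N}"]) auto

text \<open>The normals of the vertex opposite to a side are the directions opposite to the normals of that
  side, and no others.\<close>

lemma opposite_side:
  assumes "supp_pt (\<phi> + pi) = supp_pt (e (2 * i + 1) + pi)"
  shows "supp_pt \<phi> \<in> side_arc i"
proof -
  have ev: "even (2 * i + 1 + N)" by simp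
  obtain q :: int where "e (2 * i + 1 + N) \<le> \<phi> + pi + 2 * pi * of_int q"
    "\<phi> + pi + 2 * pi * of_int q \<le> e (2 * i + 1 + N + 1)"
    using vertex_normal_cone[OF ev] assms period by metis
  moreover have "e (2 * i + 1 + N + 1) = e (2 * i + 2) + pi"
    using period[of "2 * i + 2"] by (simp add: algebra_simps)
  ultimately have "\<phi> + 2 * pi * of_int q \<in> {e (2 * i + 1)..e (2 * i + 2)}"
    using period[of "2 * i + 1"] by auto
  moreover have "supp_pt \<phi> = supp_pt (\<phi> + 2 * pi * of_int q)" by (simp only: supp_pt_turns)
  ultimately show ?thesis unfolding side_arc_def by (rule image_eqI[rotated])
qed

lemma normal_towards_center:
  assumes "c \<in> C" "B \<subseteq> sphere c w" "B \<subseteq> frontier C" "p \<in> B"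
  shows "\<exists>\<phi>. p = supp_pt \<phi> \<and> c = supp_pt (\<phi> + pi)"
proof -
  have d: "dist p c = w" using subsetD[OF assms(2,4)] by (simp add: dist_commute)
  have "p \<in> C" using assms(3,4) frontier_subset_closed[OF closed_C] by blast
  from diametral_pair[OF this assms(1) d] show ?thesis by blast
qed

lemma subset_opposite_side:
  assumes "c \<in> C" "B \<subseteq> sphere c w" "B \<subseteq> frontier C" "c = supp_pt (e (2 * i + 1) + pi)"
  shows "B \<subseteq> side_arc i"
proof
  fix p assume "p \<in> B"
  then obtain \<phi> where "p = supp_pt \<phi>" "c = supp_pt (\<phi> + pi)"
    using normal_towards_center[OF assms(1-3)] by blast
  then show "p \<in> side_arc i" using opposite_side[of \<phi> i] assms(4) by simp
qed

text \<open>A larger arc has the same centre, as the midpoint of the side has only one point of \<open>C\<close> at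
  distance \<open>w\<close>. But all points of \<open>C\<close> at distance \<open>w\<close> from this centre are on the side.\<close>

lemma side_arc_is_side: "side_arc i \<in> reuleaux_sides w C"
  unfolding reuleaux_sides_def
proof (intro CollectI conjI allI impI)
  show "circle_arc w (side_arc i)" "side_arc i \<subseteq> frontier C"
    by (rule circle_arc_side_arc side_arc_frontier)+
  fix B assume B: "circle_arc w B \<and> side_arc i \<subseteq> B \<and> B \<subseteq> frontier C"
  then obtain c where c: "c \<in> C" "B \<subseteq> sphere c w" using boundary_arc_center by metis
  have diam: "\<exists>\<phi>. p = supp_pt \<phi> \<and> c = supp_pt (\<phi> + pi)" if "p \<in> B" for p
    using normal_towards_center[OF c(1,2) _ that] B by blast
  define \<theta> where "\<theta> = (e (2 * i + 1) + e (2 * i + 2)) / 2"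
  have \<theta>: "e (2 * i + 1) < \<theta>" "\<theta> < e (2 * i + 1 + 1)"
    using e_less[of "2 * i + 1" "2 * i + 2"] by (auto simp: \<theta>_def add.assoc)
  then have "supp_pt \<theta> \<in> B" using B unfolding side_arc_def by (auto simp: add.assoc)
  then obtain \<phi> where \<phi>: "supp_pt \<theta> = supp_pt \<phi>" "c = supp_pt (\<phi> + pi)" using diam by blast
  have "odd (2 * i + 1)" by simp
  then obtain q :: int where "\<phi> + 2 * pi * of_int q = \<theta>" using side_point_normal[OF _ \<theta>] \<phi>(1) by metis
  then have "\<theta> + pi = \<phi> + pi + 2 * pi * of_int q" by simp
  then have "c = supp_pt (\<theta> + pi)" using \<phi>(2) supp_pt_turns by metis
  also have "\<dots> = supp_pt (e (2 * i + 1) + pi)" using side[of "2 * i + 1" \<theta>] \<theta> by simp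
  finally have "B \<subseteq> side_arc i" using subset_opposite_side[OF c] B by blast
  then show "B = side_arc i" using B by blast
qed

text \<open>The directions from the centre to two points of the arc are, up to sign, two normals of \<open>C\<close> at the centre;
  hence the centre is a vertex, and the arc is contained in the side opposite to it.\<close>

lemma side_is_side_arc:
  assumes "A \<in> reuleaux_sides w C"
  shows "\<exists>i. A = side_arc i"
proof -
  have A: "circle_arc w A" "A \<subseteq> frontier C"
    and max: "\<And>B. circle_arc w B \<Longrightarrow> A \<subseteq> B \<Longrightarrow> B \<subseteq> frontier C \<Longrightarrow> B = A"
    using assms unfolding reuleaux_sides_def by auto
  obtain c p q where c: "c \<in> C" "A \<subseteq> sphere c w" "p \<in> A" "q \<in> A" "p \<noteq> q"
    using boundary_arc_center[OF A] by metis
  have diam: "\<exists>\<phi>. p = supp_pt \<phi> \<and> c = supp_pt (\<phi> + pi)" if "p \<in> A" for p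
    using normal_towards_center[OF c(1,2) A(2) that] .
  obtain \<phi>1 \<phi>2 where \<phi>: "p = supp_pt \<phi>1" "c = supp_pt (\<phi>1 + pi)" "q = supp_pt \<phi>2" "c = supp_pt (\<phi>2 + pi)"
    using diam c(3,4) by metis
  obtain n :: int where n: "\<phi>1 + pi - pi < \<phi>2 + pi + 2 * pi * of_int n" "\<phi>2 + pi + 2 * pi * of_int n < \<phi>1 + pi + pi"
    using same_supp_pt_near[of "\<phi>1 + pi" "\<phi>2 + pi"] \<phi> by metis
  define \<psi> where "\<psi> = \<phi>2 + pi + 2 * pi * of_int n"
  have \<psi>: "supp_pt \<psi> = c" unfolding \<psi>_def supp_pt_turns using \<phi>(4) by simp
  have "\<psi> \<noteq> \<phi>1 + pi"
  proof
    assume "\<psi> = \<phi>1 + pi"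
    then have "\<phi>1 = \<phi>2 + 2 * pi * of_int n" by (simp add: \<psi>_def)
    then show False using c(5) \<phi>(1,3) supp_pt_turns by metis
  qed
  define a b where "a = min \<psi> (\<phi>1 + pi)" and "b = max \<psi> (\<phi>1 + pi)"
  have ab: "a < b" "b < a + pi" "supp_pt a = c" "supp_pt b = c"
    using \<open>\<psi> \<noteq> \<phi>1 + pi\<close> \<psi> \<phi>(2) n by (auto simp: a_def b_def \<psi>_def min_def max_def)
  obtain j where j: "e j \<le> a" "a < e (j + 1)" by (rule locate)
  have "even j"
  proof (rule ccontr)
    assume "odd j"
    define x where "x = min b (e (j + 1))"
    have x: "a \<le> x" "a < x" "x \<le> b" "x \<le> e (j + 1)" using ab j by (auto simp: x_def)
    have "supp_pt x = supp_pt a" using normal_cone_convex[OF x(1,3) ab(2)] ab by simp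
    then show False using side_injective[OF \<open>odd j\<close> j(1) x(2,4)] by simp
  qed
  have "odd (j - N)" using \<open>even j\<close> by simp
  then obtain i where i: "j - N = 2 * i + 1" using oddE by blast
  then have "e j = e (2 * i + 1) + pi" using period[of "2 * i + 1"] by (simp add: algebra_simps)
  then have "c = supp_pt (e (2 * i + 1) + pi)"
    using vertex[OF \<open>even j\<close> j(1)] j(2) ab(3) by simp
  then have "A \<subseteq> side_arc i" by (rule subset_opposite_side[OF c(1,2) A(2)])
  then show ?thesis using max[OF circle_arc_side_arc _ side_arc_frontier] by metis
qed

lemma card_sides: "card (reuleaux_sides w C) = 2 * s + 1"
proof -
  have "reuleaux_sides w C = side_arc ` {0..<N}"
  proof
    show "side_arc ` {0..<N} \<subseteq> reuleaux_sides w C" using side_arc_is_side by blast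
    show "reuleaux_sides w C \<subseteq> side_arc ` {0..<N}"
    proof
      fix A assume "A \<in> reuleaux_sides w C"
      then obtain i where "A = side_arc (i mod N)" using side_is_side_arc side_arc_period by metis
      moreover have "i mod N \<in> {0..<N}" using pos_mod_bound[of N i] pos_mod_sign[of N i] by simp
      ultimately show "A \<in> side_arc ` {0..<N}" by blast
    qed
  qed
  moreover have "inj_on side_arc {0..<N}"
  proof (rule linorder_inj_onI)
    fix i j assume ij: "i < j" "i \<in> {0..<N}" "j \<in> {0..<N}"
    show "side_arc i \<noteq> side_arc j"
    proof
      assume eq: "side_arc i = side_arc j"
      define \<theta> where "\<theta> = (e (2 * i + 1) + e (2 * i + 2)) / 2"
      have \<theta>: "e (2 * i + 1) < \<theta>" "\<theta> < e (2 * i + 1 + 1)"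
        using e_less[of "2 * i + 1" "2 * i + 2"] by (auto simp: \<theta>_def add.assoc)
      then have "supp_pt \<theta> \<in> side_arc j" unfolding eq[symmetric] unfolding side_arc_def by (auto simp: add.assoc)
      then obtain \<phi> where \<phi>: "e (2 * j + 1) \<le> \<phi>" "\<phi> \<le> e (2 * j + 2)" "supp_pt \<phi> = supp_pt \<theta>"
        unfolding side_arc_def by auto
      have "odd (2 * i + 1)" by simp
      then obtain q :: int where q: "\<phi> + 2 * pi * of_int q = \<theta>" using side_point_normal[OF _ \<theta> \<phi>(3)] by metis
      have "e (2 * i + 1 + 1) \<le> e (2 * j + 1)" "e (2 * j + 2) \<le> e (2 * i + 1 + N + N)"
        unfolding e_le using ij by auto
      moreover have "e (2 * i + 1 + N + N) = e (2 * i + 1) + 2 * pi"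
        using period[of "2 * i + 1"] period[of "2 * i + 1 + N"] by simp
      ultimately have "\<theta> < \<phi>" "\<phi> < \<theta> + 2 * pi" using \<theta> \<phi> by linarith+
      then have "dir \<theta> \<noteq> dir \<phi>" by (rule dir_neq)
      then show False using dir_plus_turns[of \<phi> q] q by simp
    qed
  qed auto
  ultimately show ?thesis by (simp add: card_image)
qed

section \<open>The numbers of a Reuleaux polygon\<close>

text \<open>The vertices in the order in which consecutive ones are diametral form an odd cycle, and no
  member of the cover contains two neighbours of it, hence at most \<open>s\<close> of the \<open>2 s + 1\<close> vertices.\<close>

lemma polygon_lower_bound:
  assumes "borsuk_coverable k C m"
  shows "k * (2 * s + 1) \<le> s * m"
proof -
  obtain F where F: "kfold_cover k C m F" "\<And>i. i < m \<Longrightarrow> bounded (F i) \<and> diameter (F i) < w"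
    using assms unfolding borsuk_coverable_def diameter_eq_width by blast
  define V where "V i = supp_pt (e (2 * i))" for i
  have VC: "V i \<in> C" for i by (simp add: V_def supp_pt)
  have V_per: "V (i mod N) = V i" for i
  proof -
    have "2 * i = 2 * (i div N * N + i mod N)" by (simp only: div_mult_mod_eq)
    also have "\<dots> = 2 * (i mod N) + N * (2 * (i div N))" by (simp only: algebra_simps)
    finally have "2 * i = 2 * (i mod N) + N * (2 * (i div N))" .
    then have "e (2 * i) = e (2 * (i mod N)) + pi * of_int (2 * (i div N))"
      using period_multiple[of e N pi, OF period] by metis
    then have "e (2 * i) = e (2 * (i mod N)) + 2 * pi * of_int (i div N)" by simp
    then show ?thesis unfolding V_def using supp_pt_turns by metis
  qed
  have nbr: "dist (V i) (V (i + int s + 1)) = w" for i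
  proof -
    have "2 * (i + int s + 1) = 2 * i + 1 + N" by simp
    then have "V (i + int s + 1) = supp_pt (e (2 * i + 1) + pi)" unfolding V_def using period by metis
    moreover have "V i = supp_pt (e (2 * i + 1))" unfolding V_def using vertex_ends[of "2 * i"] by simp
    ultimately show ?thesis using dist_opposite by simp
  qed
  have few: "card {j \<in> {0..<N}. V j \<in> F i} \<le> s" if i: "i < m" for i
  proof -
    define J where "J = {j \<in> {0..<N}. V j \<in> F i}"
    \<comment> \<open>The next vertex of the odd cycle: the end of the normal cone of a vertex is opposite to the
      beginning of the normal cone \<open>s + 1\<close> vertices further along the boundary.\<close>
    define h where "h j = (j + int s + 1) mod N" for j
    have J: "J \<subseteq> {0..<N}" by (auto simp: J_def)
    have finJ: "finite J" by (rule finite_subset[OF J]) simp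
    have hN: "h j \<in> {0..<N}" for j
      unfolding h_def using pos_mod_bound[of N "j + int s + 1"] pos_mod_sign[of N "j + int s + 1"] by simp
    have hV: "V (h j) = V (j + int s + 1)" for j by (simp add: h_def V_per)
    have "inj_on h {0..<N}"
    proof (rule inj_onI)
      fix a b assume ab: "a \<in> {0..<N}" "b \<in> {0..<N}" "h a = h b"
      have "N dvd (a + int s + 1) - (b + int s + 1)" using ab(3) unfolding h_def mod_eq_dvd_iff .
      then have "N dvd a - b" by simp
      moreover have "\<bar>a - b\<bar> < N" using ab by auto
      ultimately show "a = b" using dvd_imp_le_int[of "a - b" N] by auto
    qed
    then have card_h: "card (h ` J) = card J" using J by (metis card_image inj_on_subset)
    have "h ` J \<inter> J = {}"
    proof -
      have False if "j \<in> J" "h j \<in> J" for j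
      proof -
        have "dist (V j) (V (h j)) \<le> diameter (F i)"
          using that F(2)[OF i] by (intro diameter_bounded_bound) (auto simp: J_def)
        then show False using F(2)[OF i] nbr[of j] by (simp add: hV)
      qed
      then show ?thesis by blast
    qed
    then have "card (h ` J) + card J = card (h ` J \<union> J)"
      using finJ by (intro card_Un_disjoint[symmetric]) auto
    also have "\<dots> \<le> card {0..<N}" using J hN by (intro card_mono) auto
    finally have "2 * card J \<le> 2 * s + 1" using card_h by simp
    then show ?thesis unfolding J_def by simp
  qed
  have "nat N = 2 * s + 1" by simp
  then have "k * (2 * s + 1) = (\<Sum>j\<in>{0..<N}. k)" by (simp only: sum_constant card_atLeastLessThan_int diff_zero mult.commute of_nat_id)
  also have "\<dots> \<le> (\<Sum>j\<in>{0..<N}. card {i. i < m \<and> V j \<in> F i})"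
    using F(1) VC unfolding kfold_cover_def by (intro sum_mono) auto
  also have "\<dots> = (\<Sum>j\<in>{0..<N}. \<Sum>i<m. of_bool (V j \<in> F i))"
  proof (rule sum.cong[OF refl])
    fix j
    have "{i. i < m \<and> V j \<in> F i} = {..<m} \<inter> {i. V j \<in> F i}" by auto
    then show "card {i. i < m \<and> V j \<in> F i} = (\<Sum>i<m. of_bool (V j \<in> F i))" by (simp add: sum_of_bool_eq)
  qed
  also have "\<dots> = (\<Sum>i<m. \<Sum>j\<in>{0..<N}. of_bool (V j \<in> F i))" by (rule sum.swap)
  also have "\<dots> = (\<Sum>i<m. card {j \<in> {0..<N}. V j \<in> F i})"
  proof (rule sum.cong[OF refl])
    fix i
    have "{j \<in> {0..<N}. V j \<in> F i} = {0..<N} \<inter> {j. V j \<in> F i}" by auto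
    then show "(\<Sum>j\<in>{0..<N}. of_bool (V j \<in> F i)) = card {j \<in> {0..<N}. V j \<in> F i}" by (simp add: sum_of_bool_eq)
  qed
  also have "\<dots> \<le> (\<Sum>i<m. s)" using few by (intro sum_mono) auto
  finally show ?thesis by (simp add: mult.commute)
qed

text \<open>Shifting by \<open>m\<close> half turns makes every interval the normal cone of a vertex.\<close>

lemma sign_constant:
  assumes "e (int m) \<le> \<theta>" "\<theta> \<le> e (int m + 1)"
  shows "supp_pt (\<theta> + real m * pi) = supp_pt (e (int m) + real m * pi)"
proof (cases "even m")
  case True
  then obtain l where l: "m = 2 * l" by blast
  have "\<phi> + real m * pi = \<phi> + 2 * pi * of_int (int l)" for \<phi> by (simp add: l)
  then have "supp_pt (\<phi> + real m * pi) = supp_pt \<phi>" for \<phi> by (simp only: supp_pt_turns)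
  moreover have "even (int m)" using True by simp
  ultimately show ?thesis using vertex[OF _ assms] by metis
next
  case False
  then obtain l where l: "m = 2 * l + 1" using oddE by blast
  have "\<phi> + real m * pi = \<phi> + pi + 2 * pi * of_int (int l)" for \<phi> by (simp add: l algebra_simps)
  then have "supp_pt (\<phi> + real m * pi) = supp_pt (\<phi> + pi)" for \<phi> by (simp only: supp_pt_turns)
  moreover have "odd (int m)" using False by simp
  ultimately show ?thesis using side[OF _ assms] by metis
qed

text \<open>The ends of the arcs are interior points of \<open>2 k + 1\<close> consecutive sides, in the order modulo half
  turns; the ends of these intervals separate them. The normal cones of interior points of sides are
  single directions.\<close>

lemma short_cover:
  assumes k: "1 \<le> k" "k \<le> s"
  shows "borsuk_coverable k C (2 * k + 1)"
proof -
  define n where "n = 2 * k + 1"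
  define t where "t j = (e (int j + 1) + e (int j + 2)) / 2" for j :: nat
  have t: "e (int j + 1) < t j" "t j < e (int j + 2)" for j
    using e_less[of "int j + 1" "int j + 2"] by (auto simp: t_def)
  define f where "f m = (if even m then t (m div 2) else e (int (m div 2) + 2))" for m
  have f: "f (2 * j) = t j" "f (2 * j + 1) = e (int j + 2)" for j by (simp_all add: f_def)
  have inc: "f m < f (Suc m)" for m
  proof (cases "even m")
    case True
    then obtain j where "m = 2 * j" by blast
    then show ?thesis using f[of j] t[of j] by simp
  next
    case False
    then obtain j where "m = 2 * j + 1" using oddE by blast
    then show ?thesis using f(2)[of j] f(1)[of "Suc j"] t(1)[of "Suc j"] by (simp add: algebra_simps)
  qed
  have flip: "supp_pt (a + real j * pi) \<noteq> supp_pt (b + real j * pi)"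
    if "e (int j + 1) \<le> a" "a < b" "b \<le> e (int j + 2)" for a b and j :: nat
  proof
    assume eq: "supp_pt (a + real j * pi) = supp_pt (b + real j * pi)"
    have "b < a + 2 * pi" using gap[of "int j + 1"] that pi_gt_zero by (simp add: add.assoc)
    then have "supp_pt (a + real j * pi + pi) \<noteq> supp_pt (b + real j * pi + pi)"
      using not_both_constant[OF _ _ eq] that(2) by simp
    moreover have "supp_pt (a + real (j + 1) * pi) = supp_pt (b + real (j + 1) * pi)"
      using sign_constant[of "j + 1" a] sign_constant[of "j + 1" b] that by (simp add: add.commute add.left_commute)
    ultimately show False by (simp add: algebra_simps)
  qed
  show ?thesis
  proof (rule cover_of_interleaved_arcs[where f = f], fold n_def)
    show "f i < f j" if "i < j" for i j using lift_Suc_mono_less[of f, OF inc that] .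
    have last: "f (2 * n - 1) = e (int n + 1)"
    proof -
      have "2 * n - 1 = 2 * (n - 1) + 1" "int (n - 1) + 2 = int n + 1" by (simp_all add: n_def)
      then show ?thesis using f(2)[of "n - 1"] by metis
    qed
    have "e (int n + 1) \<le> e (1 + N)" unfolding e_le using k by (simp add: n_def)
    then have le: "e (int n + 1) \<le> e 1 + pi" using period[of 1] by simp
    have f0: "e 1 < f 0" "f 0 < e 2" using f(1)[of 0] t[of 0] by auto
    show "f (2 * n - 1) < f 0 + pi" using last le f0 by simp
    show "supp_pt (f (2 * j) + real j * pi) \<noteq> supp_pt (f (2 * j + 1) + real j * pi)" for j
      unfolding f using t[of j] by (intro flip) auto
    show "supp_pt (f (2 * j - 1) + real j * pi) \<noteq> supp_pt (f (2 * j) + real j * pi)" if "0 < j" for j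
    proof -
      have "2 * j - 1 = 2 * (j - 1) + 1" "int (j - 1) + 2 = int j + 1" using that by auto
      then have "f (2 * j - 1) = e (int j + 1)" using f(2)[of "j - 1"] by metis
      then show ?thesis unfolding f using t[of j] by (simp add: flip)
    qed
    show "supp_pt (f (2 * n - 1) - pi) \<noteq> supp_pt (f 0)"
    proof
      assume eq: "supp_pt (f (2 * n - 1) - pi) = supp_pt (f 0)"
      have "e 2 < e (int n + 1)" unfolding e_less using k by (simp add: n_def)
      then have "f (2 * n - 1) - pi \<le> e 1" "e 1 \<le> f 0" "f 0 < f (2 * n - 1) - pi + pi"
        using le f0 unfolding last by linarith+
      from normal_cone_convex[OF this eq] have "supp_pt (e 1) = supp_pt (f 0)" using eq by simp
      then show False using side_injective[of 1 "e 1" "f 0"] f0 by simp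
    qed
  qed
qed

text \<open>Splitting off one \<open>s\<close>-fold cover with \<open>2 s + 1\<close> members lowers \<open>k\<close> by \<open>s\<close> and the rounded quotient by one.\<close>

lemma polygon_cover:
  assumes s: "1 \<le> s" and "1 \<le> k"
  shows "borsuk_coverable k C (nat (2 * int k + \<lceil>real k / real s\<rceil>))"
  using assms(2)
proof (induction k rule: less_induct)
  case (less k)
  show ?case
  proof (cases "k \<le> s")
    case True
    then have "\<lceil>real k / real s\<rceil> = 1" using less.prems by (simp add: ceiling_eq_iff)
    then show ?thesis using short_cover[OF less.prems True] by (simp add: nat_add_distrib nat_mult_distrib)
  next
    case False
    then have k: "k - s < k" "1 \<le> k - s" using s by auto
    have "real (k - s) / real s = real k / real s - 1" using False s by (simp add: of_nat_diff field_simps)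
    then have c: "\<lceil>real (k - s) / real s\<rceil> = \<lceil>real k / real s\<rceil> - 1" by simp
    have arith: "nat (2 * int (k - s) + A) + (2 * s + 1) = nat (2 * int k + B)"
      if "0 < A" "A = B - 1" "s < k" for A B :: int
      using that by linarith
    have "0 < \<lceil>real (k - s) / real s\<rceil>" using k s by simp
    from arith[OF this c] False
    have "nat (2 * int (k - s) + \<lceil>real (k - s) / real s\<rceil>) + (2 * s + 1) = nat (2 * int k + \<lceil>real k / real s\<rceil>)"
      by simp
    then show ?thesis
      using borsuk_coverable_add[OF less.IH[OF k] short_cover[OF s order_refl]] False by simp
  qed
qed

lemma polygon_borsuk_number:
  assumes "1 \<le> s" "1 \<le> k"
  shows "int (kfold_borsuk_number k C) = 2 * int k + \<lceil>real k / real s\<rceil>"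
proof -
  have pos: "0 < 2 * int k + \<lceil>real k / real s\<rceil>" using assms by (simp add: add_pos_pos)
  have "kfold_borsuk_number k C = nat (2 * int k + \<lceil>real k / real s\<rceil>)"
  proof (rule kfold_borsuk_number_eqI[OF polygon_cover[OF assms]])
    show "0 < nat (2 * int k + \<lceil>real k / real s\<rceil>)" using pos by simp
    fix m assume "borsuk_coverable k C m"
    then have "real (k * (2 * s + 1)) \<le> real (s * m)" using polygon_lower_bound of_nat_le_iff by blast
    then have "real k / real s \<le> real m - 2 * real k" using assms(1) by (simp add: field_simps)
    then have "\<lceil>real k / real s\<rceil> \<le> int m - 2 * int k" by (simp add: ceiling_le_iff)
    then show "nat (2 * int k + \<lceil>real k / real s\<rceil>) \<le> m" by simp
  qed
  then show ?thesis using pos by simp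
qed

end

section \<open>Bodies with finitely many switching directions\<close>

context constant_width_body
begin

lemma locally_constant_closed_interval:
  fixes g :: "real \<Rightarrow> real^2"
  assumes "a < b" "continuous_on UNIV g"
    and "\<And>\<theta>. a < \<theta> \<Longrightarrow> \<theta> < b \<Longrightarrow> \<exists>U. open U \<and> \<theta> \<in> U \<and> (\<forall>x\<in>U. g x = g \<theta>)"
  shows "g a = g b"
proof -
  define m where "m = (a + b) / 2"
  have m: "m \<in> {a<..<b}" using assms(1) by (simp add: m_def)
  have "g x = g m" if "x \<in> {a<..<b}" for x
  proof (rule connected_local_const[OF connected_Ioo[of a b] that m], rule ballI)
    fix \<theta> assume "\<theta> \<in> {a<..<b}"
    then obtain U where U: "open U" "\<theta> \<in> U" "\<forall>x\<in>U. g x = g \<theta>" using assms(3)[of \<theta>] by auto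
    then show "eventually (\<lambda>x. g \<theta> = g x) (at \<theta> within {a<..<b})"
      unfolding eventually_at_topological by metis
  qed
  then have "g x = g m" if "x \<in> closure {a<..<b}" for x
    using continuous_constant_on_closure[OF continuous_on_subset[OF assms(2)] _ that] by blast
  moreover have "a \<in> closure {a<..<b}" "b \<in> closure {a<..<b}" using assms(1) by auto
  ultimately show ?thesis by metis
qed

text \<open>On an interval without switching directions each direction has a neighbourhood on which the
  support point or the opposite one is constant. These alternatives exclude each other, and the
  interval is connected, so the same one holds throughout.\<close>

lemma constant_between_switches:
  assumes ab: "a < b" "b \<le> a + pi" and ns: "\<And>\<theta>. a < \<theta> \<Longrightarrow> \<theta> < b \<Longrightarrow> \<not> switching \<theta>"
  shows "supp_pt a = supp_pt b \<or> supp_pt (a + pi) = supp_pt (b + pi)"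
proof -
  define cones where "cones g = \<Union>{{x<..<y} | x y. y < x + pi \<and> supp_pt (g x) = supp_pt (g y)}"
    for g :: "real \<Rightarrow> real"
  have conesI: "\<theta> \<in> cones g" if "x < \<theta>" "\<theta> < y" "y < x + pi" "supp_pt (g x) = supp_pt (g y)" for \<theta> x y g
    unfolding cones_def using that by (intro UnionI[of "{x<..<y}"]) auto
  have op: "open (cones g)" for g unfolding cones_def by (intro open_Union) auto
  have const: "\<exists>x y. x < \<theta> \<and> \<theta> < y \<and> (\<forall>z\<in>{x<..<y}. supp_pt (z + \<sigma>) = supp_pt (\<theta> + \<sigma>))"
    if t: "\<theta> \<in> cones (\<lambda>z. z + \<sigma>)" for \<theta> \<sigma>
  proof -
    obtain x y where xy: "x < \<theta>" "\<theta> < y" "y < x + pi" "supp_pt (x + \<sigma>) = supp_pt (y + \<sigma>)"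
      using t unfolding cones_def by auto
    have "supp_pt (z + \<sigma>) = supp_pt (x + \<sigma>)" if "z \<in> {x<..<y}" for z
      using that xy(3) by (intro normal_cone_convex[OF _ _ _ xy(4)]) auto
    then show ?thesis using xy(1,2) by (metis greaterThanLessThan_iff)
  qed
  let ?U = "cones (\<lambda>z. z + 0)" and ?V = "cones (\<lambda>z. z + pi)"
  have "\<theta> \<notin> ?V" if "\<theta> \<in> ?U" for \<theta>
  proof
    assume "\<theta> \<in> ?V"
    then obtain x y where xy: "x < \<theta>" "\<theta> < y" "\<forall>z\<in>{x<..<y}. supp_pt (z + pi) = supp_pt (\<theta> + pi)"
      using const by blast
    obtain x' y' where xy': "x' < \<theta>" "\<theta> < y'" "\<forall>z\<in>{x'<..<y'}. supp_pt (z + 0) = supp_pt (\<theta> + 0)"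
      using const[OF \<open>\<theta> \<in> ?U\<close>] by blast
    obtain z where z: "\<theta> < z" "z < min (min y y') (\<theta> + pi)"
      using dense[of \<theta> "min (min y y') (\<theta> + pi)"] xy(2) xy'(2) pi_gt_zero by auto
    then have "z \<in> {x<..<y}" "z \<in> {x'<..<y'}" "z < \<theta> + 2 * pi" using xy(1) xy'(1) by auto
    then have "supp_pt (z + pi) = supp_pt (\<theta> + pi)" "supp_pt (z + 0) = supp_pt (\<theta> + 0)"
      using xy(3) xy'(3) by blast+
    then show False using not_both_constant[OF z(1) \<open>z < \<theta> + 2 * pi\<close>] by simp
  qed
  then have disj: "?U \<inter> ?V \<inter> {a<..<b} = {}" by blast
  have "{a<..<b} \<subseteq> ?U \<union> ?V"
  proof
    fix \<theta> assume "\<theta> \<in> {a<..<b}"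
    then have "\<not> switching \<theta>" using ns by simp
    then obtain x y where "x < \<theta>" "\<theta> < y" "y < x + pi"
      "supp_pt x = supp_pt y \<or> supp_pt (x + pi) = supp_pt (y + pi)"
      unfolding switching_def by blast
    then show "\<theta> \<in> ?U \<union> ?V" using conesI[of x \<theta> y "\<lambda>z. z + 0"] conesI[of x \<theta> y "\<lambda>z. z + pi"] by auto
  qed
  then have "?U \<inter> {a<..<b} = {} \<or> ?V \<inter> {a<..<b} = {}"
    using connectedD[OF connected_Ioo op op disj] by blast
  then have "{a<..<b} \<subseteq> ?U \<or> {a<..<b} \<subseteq> ?V" using \<open>{a<..<b} \<subseteq> ?U \<union> ?V\<close> by blast
  moreover have "supp_pt (a + \<sigma>) = supp_pt (b + \<sigma>)" if sub: "{a<..<b} \<subseteq> cones (\<lambda>z. z + \<sigma>)" for \<sigma>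
  proof (rule locally_constant_closed_interval[OF ab(1)])
    show "continuous_on UNIV (\<lambda>z. supp_pt (z + \<sigma>))"
      by (rule continuous_on_compose2[OF continuous_on_supp_pt[of UNIV]]) (auto intro: continuous_intros)
    fix \<theta> assume "a < \<theta>" "\<theta> < b"
    then have "\<theta> \<in> cones (\<lambda>z. z + \<sigma>)" using sub by auto
    from const[OF this]
    obtain x y where xy: "x < \<theta>" "\<theta> < y" and c: "\<forall>z\<in>{x<..<y}. supp_pt (z + \<sigma>) = supp_pt (\<theta> + \<sigma>)"
      by blast
    then show "\<exists>U. open U \<and> \<theta> \<in> U \<and> (\<forall>x\<in>U. supp_pt (x + \<sigma>) = supp_pt (\<theta> + \<sigma>))"
    proof (intro exI conjI)
      show "open {x<..<y}" "\<theta> \<in> {x<..<y}" using xy by simp_all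
    qed (rule c)
  qed
  ultimately show ?thesis by (metis add.right_neutral)
qed

lemma switching_turns: "switching (z + pi * of_int q) \<longleftrightarrow> switching z"
proof (induction q rule: int_induct[of _ 0])
  case (step1 i)
  then show ?case using switching_add_pi[of "z + pi * of_int i"] by (simp add: algebra_simps)
next
  case (step2 i)
  then show ?case using switching_add_pi[of "z + pi * of_int (i - 1)"] by (simp add: algebra_simps)
qed simp

text \<open>Between neighbouring switching directions the support point or its opposite is constant. The two
  possibilities alternate: a point that is constant on both sides of a direction is constant near it.
  Since the opposite of a vertex interval is a side interval half a turn later, the number of
  intervals in a half turn is odd.\<close>

lemma reuleaux_angles_if_finite:
  assumes fin: "finite {z \<in> {0..<pi}. switching z}"
  obtains e s where "reuleaux_angles C w e s"
proof -
  define Z where "Z = {z \<in> {0..<pi}. switching z}"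
  define M where "M = card Z"
  have "Z \<noteq> {}"
  proof
    assume Z: "Z = {}"
    have "\<not> switching \<theta>" if "0 < \<theta>" "\<theta> < pi" for \<theta> using that Z by (auto simp: Z_def)
    then have "supp_pt 0 = supp_pt (0 + pi) \<or> supp_pt (0 + pi) = supp_pt (0 + pi + pi)"
      using constant_between_switches[of 0 "0 + pi"] pi_gt_zero by auto
    then show False using supp_pt_opposite_neq by blast
  qed
  moreover have finZ: "finite Z" unfolding Z_def by (rule fin)
  ultimately have M: "0 < M" unfolding M_def card_gt_0_iff ..
  obtain f :: "nat \<Rightarrow> real"
    where f: "(\<forall>i j. i < j \<and> j < M \<longrightarrow> f i < f j) \<and> f ` {..<M} = Z"
    using enumerate_finite_set[OF finZ] unfolding M_def by (rule exE)
  have im: "f ` {..<M} = Z" using f by (rule conjunct2)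
  have inc: "f i < f j" if "i < j" "j < M" for i j
    using conjunct1[OF f, rule_format, of i j] that by simp
  have fZ: "0 \<le> f i" "f i < pi" "switching (f i)" if "i < M" for i
  proof -
    have "f i \<in> Z" unfolding im[symmetric] using that by (intro imageI) simp
    then show "0 \<le> f i" "f i < pi" "switching (f i)" by (simp_all add: Z_def)
  qed
  have last: "f (M - 1) < f 0 + pi" using fZ(1)[of 0] fZ(2)[of "M - 1"] M by simp
  obtain e :: "int \<Rightarrow> real" where e: "strict_mono e"
    and per: "\<And>j. e (j + int M) = e j + pi"
    and val: "\<And>q r. r < M \<Longrightarrow> e (q * int M + int r) = f r + pi * of_int q"
    using periodic_extension[OF M inc last] by blast
  have sw: "switching (e j)" for j
  proof -
    have r: "nat (j mod int M) < M" using M by (simp add: nat_less_iff)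
    have "e j = f (nat (j mod int M)) + pi * of_int (j div int M)"
      using val[OF r, of "j div int M"] M by simp
    then show ?thesis using fZ(3)[OF r] switching_turns by simp
  qed
  have all: "\<exists>j. z = e j" if "switching z" for z
  proof -
    define q where "q = \<lfloor>z / pi\<rfloor>"
    have "of_int q \<le> z / pi" "z / pi < of_int q + 1" unfolding q_def by linarith+
    then have "0 \<le> z - pi * of_int q" "z - pi * of_int q < pi" by (auto simp: field_simps)
    moreover have "switching (z - pi * of_int q)"
      using switching_turns[of "z - pi * of_int q" q] that by simp
    ultimately have "z - pi * of_int q \<in> f ` {..<M}" unfolding im Z_def by simp
    then obtain r where "r < M" "z - pi * of_int q = f r" by auto
    then have "z = e (q * int M + int r)" using val[of r q] by simp
    then show ?thesis ..
  qed
  define vtx where "vtx j \<longleftrightarrow> supp_pt (e j) = supp_pt (e (j + 1))" for j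
  have step: "e j < e (j + 1)" "e (j + 1) \<le> e j + pi" for j
    using e M unfolding per[of j, symmetric] by (auto simp: strict_mono_less strict_mono_less_eq)
  have either: "vtx j \<or> vtx (j + int M)" for j
  proof -
    have "\<not> switching \<theta>" if "e j < \<theta>" "\<theta> < e (j + 1)" for \<theta>
    proof
      assume "switching \<theta>"
      then obtain i where "\<theta> = e i" using all by blast
      then show False using that e by (simp add: strict_mono_less)
    qed
    then have "supp_pt (e j) = supp_pt (e (j + 1)) \<or> supp_pt (e j + pi) = supp_pt (e (j + 1) + pi)"
      by (rule constant_between_switches[OF step])
    then show ?thesis using per[of j] per[of "j + 1"] by (simp add: vtx_def algebra_simps)
  qed
  have not_next: "\<not> vtx (j + 1)" if v: "vtx j" for j
  proof
    assume v': "vtx (j + 1)"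
    have lt: "e (i + 1) < e i + pi" if "vtx i" for i
    proof -
      have "e (i + 1) \<noteq> e i + pi" using that supp_pt_opposite_neq[of "e i"] unfolding vtx_def by metis
      then show ?thesis using step(2)[of i] by simp
    qed
    obtain a where a: "max (e j) (e (j + 1) - pi / 2) < a" "a < e (j + 1)"
      using dense[of "max (e j) (e (j + 1) - pi / 2)" "e (j + 1)"] step(1)[of j] pi_gt_zero by auto
    obtain b where b: "e (j + 1) < b" "b < min (e (j + 2)) (e (j + 1) + pi / 2)"
      using dense[of "e (j + 1)" "min (e (j + 2)) (e (j + 1) + pi / 2)"] step(1)[of "j + 1"] pi_gt_zero
      by (auto simp: add.assoc)
    have "supp_pt a = supp_pt (e j)"
      using a by (intro normal_cone_convex[OF _ _ lt[OF v] v[unfolded vtx_def]]) auto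
    moreover have "supp_pt b = supp_pt (e (j + 1))"
      using b by (intro normal_cone_convex[OF _ _ lt[OF v'] v'[unfolded vtx_def]]) (auto simp: add.assoc)
    ultimately have "supp_pt a = supp_pt b" using v by (simp add: vtx_def)
    moreover have "b < a + pi" using a b by linarith
    ultimately show False using switchingD(1)[OF sw a(2) b(1)] by simp
  qed
  have flip: "vtx (j + 1) \<longleftrightarrow> \<not> vtx j" for j
  proof -
    have "j + 1 + int M = j + int M + 1" by simp
    then have "vtx (j + 1) \<or> vtx (j + int M + 1)" using either[of "j + 1"] by metis
    then show ?thesis using either[of j] not_next[of j] not_next[of "j + int M"] by blast
  qed
  have alt: "vtx j \<longleftrightarrow> (even j \<longleftrightarrow> vtx 0)" for j
  proof (induction j rule: int_induct[of _ 0])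
    case (step1 i)
    then show ?case using flip[of i] by auto
  next
    case (step2 i)
    then show ?case using flip[of "i - 1"] by auto
  qed simp
  have "\<not> (vtx 0 \<and> vtx (int M))"
  proof
    assume v: "vtx 0 \<and> vtx (int M)"
    have "e 1 \<le> e 0 + pi" using step(2)[of 0] by simp
    then have "e 1 < e 0 + 2 * pi" using pi_gt_zero by linarith
    moreover have "supp_pt (e 0) = supp_pt (e 1)" "supp_pt (e 0 + pi) = supp_pt (e 1 + pi)"
      using v per[of 0] per[of 1] by (auto simp: vtx_def add.commute)
    ultimately show False using not_both_constant[of "e 0" "e 1"] step(1)[of 0] by simp
  qed
  then have "odd M" using alt[of "int M"] either[of 0] by auto
  then obtain s where s: "M = 2 * s + 1" using oddE by blast
  \<comment> \<open>The intervals alternate, so a shift by one moves the vertices to the even indices.\<close>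
  define c :: int where "c = (if vtx 0 then 0 else 1)"
  have "reuleaux_angles C w (\<lambda>j. e (j + c)) s"
  proof
    show "strict_mono (\<lambda>j. e (j + c))" using e by (simp add: strict_mono_def)
    show "e (j + (2 * int s + 1) + c) = e (j + c) + pi" for j
      using per[of "j + c"] by (simp add: s algebra_simps)
    show "supp_pt (e (j + c)) = supp_pt (e (j + 1 + c))" if "even j" for j
    proof -
      have "vtx (j + c)" using alt[of "j + c"] that by (simp add: c_def)
      moreover have "j + c + 1 = j + 1 + c" by simp
      ultimately show ?thesis unfolding vtx_def by metis
    qed
  qed
  then show thesis by (rule that)
qed

lemma non_polygon_borsuk_number:
  assumes "\<not> reuleaux_polygon C" "1 \<le> k"
  shows "kfold_borsuk_number k C = 2 * k + 1"
proof (rule kfold_borsuk_number_eqI)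
  have "infinite {z \<in> {0..<pi}. switching z}"
  proof
    assume "finite {z \<in> {0..<pi}. switching z}"
    then obtain e s where "reuleaux_angles C w e s" by (rule reuleaux_angles_if_finite)
    then have "reuleaux_polygon_of_width w C" by (rule reuleaux_angles.is_reuleaux_polygon)
    then show False using assms(1) unfolding reuleaux_polygon_def by blast
  qed
  then show "borsuk_coverable k C (2 * k + 1)" by (rule cover_if_infinitely_many_switches)
  show "2 * k + 1 \<le> m" if "borsuk_coverable k C m" for m
    using borsuk_lower_bound[OF that assms(2)] .
qed simp

end

theorem theorem3:
  fixes C :: "(real^2) set" and k :: nat
  assumes "convex_body C" and "\<exists>w. constant_width w C" and "k \<ge> 1"
  shows "(\<forall>s::nat. s \<ge> 1 \<and> reuleaux_polygon_with_sides (2 * s + 1) C \<longrightarrow>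
            int (kfold_borsuk_number k C) = 2 * int k + \<lceil>real k / real s\<rceil>) \<and>
         (\<not> reuleaux_polygon C \<longrightarrow> kfold_borsuk_number k C = 2 * k + 1)"
proof (intro conjI allI impI)
  fix s :: nat assume s: "s \<ge> 1 \<and> reuleaux_polygon_with_sides (2 * s + 1) C"
  then obtain w where w: "reuleaux_polygon_of_width w C" "card (reuleaux_sides w C) = 2 * s + 1"
    unfolding reuleaux_polygon_with_sides_def by blast
  then interpret constant_width_body C w
    by unfold_locales (auto simp: reuleaux_polygon_of_width_def)
  obtain e s' where e: "reuleaux_angles C w e s'"
    using reuleaux_angles_if_finite[OF finitely_many_switches[OF w(1)]] .
  have "s' = s" using reuleaux_angles.card_sides[OF e] w(2) by simp
  then show "int (kfold_borsuk_number k C) = 2 * int k + \<lceil>real k / real s\<rceil>"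
    using reuleaux_angles.polygon_borsuk_number[OF e] s assms(3) by simp
next
  assume np: "\<not> reuleaux_polygon C"
  obtain w where "constant_width w C" using assms(2) by blast
  then interpret constant_width_body C w
    using assms(1) by unfold_locales
  show "kfold_borsuk_number k C = 2 * k + 1"
    using non_polygon_borsuk_number[OF np] assms(3) by simp
qed

end
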